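(* Let $0\le\sigma<1$, $0\le\xi\le 1$, $\alpha\ge 0$, $\gamma\ge 0$ (with $\alpha>0$ if $\gamma=0$), and let $\mu\ge 0,\ \nu\ge 0$ satisfy $\mu+\nu=\alpha-\gamma$, $\mu\nu=\gamma$ (with $\mu=0$, $\nu=\alpha$ when $\gamma=0$). Let $\lambda$ be a non-negative integrable function on $[0,1]$ with $\int_0^1\lambda(t)\,dt=1$, and let $\beta<1$ be given by $$\frac{\beta}{1-\beta}=-\int_0^1\lambda(t)\bigl((1-\xi)g(t)+\xi(2q(t)-1)\bigr)\,dt .$$ Assume that $t^{1/\nu}\Lambda_\nu(t)\to 0$ as $t\to 0^+$ and, if $\gamma>0$, that $t^{1/\mu}\Pi_{\mu,\nu}(t)\to 0$ as $t\to0^+$. Then $$\mathcal M_{\Pi_{\mu,\nu}}(h_\sigma)\ge 0\quad\text{(for all } z\in\mathbb D \text{ and all } |\epsilon|=1)$$ if and only if $V_\lambda(\mathcal W_\beta(\alpha,\gamma))\subset M(\sigma,\xi)$, i.e. if and only if for every $f\in\mathcal W_\beta(\alpha,\gamma)$ the function $F=V_\lambda(f)$ satisfies $\xi zF'+(1-\xi)F\in\mathcal S^*(\sigma)$. Here $$\mathcal M_{\Pi_{\mu,\nu}}(h_\sigma)=\begin{cases}\displaystyle\int_0^1 t^{1/\mu-1}\,\Pi_{\mu,\nu}(t)\,\mathcal L_{\sigma,\xi,z}(t)\,dt, & \gamma>0,\\[2mm] \displaystyle\int_0^1 t^{1/\alpha-1}\,\Pi_{0,\alpha}(t)\,\mathcal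 L_{\sigma,\xi,z}(t)\,dt, & \gamma=0,\end{cases}$$ $$\mathcal L_{\sigma,\xi,z}(t)=(1-\xi)\left(\mathrm{Re}\,\frac{h_\sigma(tz)}{tz}-\frac{1-\sigma(1+t)}{(1-\sigma)(1+t)^2}\right)+\xi\left(\mathrm{Re}\,h_\sigma'(tz)-\frac{1-\sigma-(1+\sigma)t}{(1-\sigma)(1+t)^3}\right).$$ The value of $\beta$ is sharp (i.e. it cannot be replaced by a smaller number with the inclusion $V_\lambda(\mathcal W_\beta(\alpha,\gamma))\subset M(\sigma,\xi)$ still holding).
   Context: $\mathbb D=\{z\in\mathbb C:|z|<1\}$. $\mathcal A$ is the class of analytic functions $f$ on $\mathbb D$ with $f(0)=f'(0)-1=0$; $\mathcal S\subset\mathcal A$ is the subclass of univalent functions. $\mathcal S^*(\sigma)$ ($0\le\sigma<1$) is the class of $f\in\mathcal S$ with $\mathrm{Re}(zf'(z)/f(z))>\sigma$ on $\mathbb D$. The Pascu class $M(\sigma,\xi)$ ($0\le\xi\le1$) is the class of $f\in\mathcal A$ with $$\mathrm{Re}\,\frac{\xi z(zf'(z))'+(1-\xi)zf'(z)}{\xi zf'(z)+(1-\xi)f(z)}>\sigma,\quad z\in\mathbb D,$$ equivalently $\xi zf'+(1-\xi)f\in\mathcal S^*(\sigma)$. For $\alpha,\gamma\ge0$, $\beta<1$, $\mathcal W_\beta(\alpha,\gamma)$ is the class of $f\in\mathcal A$ for which there is $\phi\in\mathbb R$ with $$\mathrm{Re}\left(e^{i\phi}\left((1-\alpha+2\gamma)\tfrac{f(z)}{z}+(\alpha-2\gamma)f'(z)+\gamma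 zf''(z)-\beta\right)\right)>0,\quad z\in\mathbb D.$$ $V_\lambda(f)(z)=\int_0^1\lambda(t)\frac{f(tz)}{t}\,dt$. The functions $g,q$ on $[0,1]$ are: for $\gamma>0$, $$g(t)=\frac{2}{\mu\nu}\int_0^1\!\!\int_0^1\frac{1-\sigma(1+swt)}{(1-\sigma)(1+swt)^2}s^{1/\mu-1}w^{1/\nu-1}\,ds\,dw-1,$$ $$q(t)=\frac{1}{\mu\nu}\int_0^1\!\!\int_0^1\frac{1-\sigma-(1+\sigma)swt}{(1-\sigma)(1+swt)^3}s^{1/\mu-1}w^{1/\nu-1}\,ds\,dw;$$ for $\gamma=0$, $\alpha>0$, $$g(t)=\frac{2}{\alpha}t^{-1/\alpha}\int_0^t\frac{1-\sigma(1+s)}{(1-\sigma)(1+s)^2}s^{1/\alpha-1}ds-1,\qquad q(t)=\frac1\alpha t^{-1/\alpha}\int_0^t\frac{1-\sigma-(1+\sigma)s}{(1-\sigma)(1+s)^3}s^{1/\alpha-1}ds.$$ $\Lambda_\nu(t)=\int_t^1\frac{\lambda(x)}{x^{1/\nu}}\,dx$ for $\nu>0$; $\Pi_{\mu,\nu}(t)=\int_t^1\Lambda_\nu(x)x^{1/\nu-1-1/\mu}\,dx$ if $\gamma>0$ (so $\mu,\nu>0$), and $\Pi_{0,\alpha}(t)=\Lambda_\alpha(t)$ if $\gamma=0$ ($\mu=0$, $\nu=\alpha>0$). Finally $$h_\sigma(z)=\frac{z\left(1+\frac{\epsilon+2\sigma-1}{2(1-\sigma)}z\right)}{(1-z)^2},\qquad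 |\epsilon|=1.$$ *)

theory Defs
  imports "HOL-Complex_Analysis.Complex_Analysis"
begin

text \<open>
  Functions on the unit disk are total functions \<open>complex \<Rightarrow> complex\<close>; only their values on
  \<open>ball 0 1\<close> matter.  Integrals are Lebesgue integrals.  The junk values of the integrands at the
  endpoint \<open>t = 0\<close> (from \<open>x / 0 = 0\<close> and \<open>0 powr a = 0\<close>) concern a null set only.
\<close>

definition class_A :: "(complex \<Rightarrow> complex) set" where
  "class_A = {f. f holomorphic_on ball 0 1 \<and> f 0 = 0 \<and> deriv f 0 = 1}"

definition class_S :: "(complex \<Rightarrow> complex) set" where
  "class_S = {f \<in> class_A. inj_on f (ball 0 1)}"

text \<open>
  In the next two classes the quotient has a removable singularity at \<open>0\<close> with value \<open>1 > \<sigma>\<close>,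
  so the condition at \<open>0\<close> holds and only the punctured disk is mentioned.  Since \<open>\<sigma> \<ge> 0\<close>, a
  vanishing denominator elsewhere makes the inequality false (the quotient is then \<open>0\<close>).
\<close>

definition starlike_order :: "real \<Rightarrow> (complex \<Rightarrow> complex) set" where
  "starlike_order \<sigma> =
     {f \<in> class_S. \<forall>z \<in> ball 0 1 - {0}. Re (z * deriv f z / f z) > \<sigma>}"

definition pascu :: "real \<Rightarrow> real \<Rightarrow> (complex \<Rightarrow> complex) set" where
  "pascu \<sigma> \<xi> =
     {f \<in> class_A. \<forall>z \<in> ball 0 1 - {0}.
        Re ((of_real \<xi> * z * deriv (\<lambda>w. w * deriv f w) z + of_real (1 - \<xi>) * z * deriv f z) /
            (of_real \<xi> * z * deriv f z + of_real (1 - \<xi>) * f z)) > \<sigma>}"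

text \<open>\<open>f z / z\<close> for \<open>f 0 = 0\<close>, with the singularity at \<open>0\<close> removed.\<close>

definition quot_id :: "(complex \<Rightarrow> complex) \<Rightarrow> complex \<Rightarrow> complex" where
  "quot_id f z = (if z = 0 then deriv f 0 else f z / z)"

definition class_W :: "real \<Rightarrow> real \<Rightarrow> real \<Rightarrow> (complex \<Rightarrow> complex) set" where
  "class_W \<beta> \<alpha> \<gamma> =
     {f \<in> class_A. \<exists>\<phi>::real. \<forall>z \<in> ball 0 1.
        Re (cis \<phi> * (of_real (1 - \<alpha> + 2 * \<gamma>) * quot_id f z + of_real (\<alpha> - 2 * \<gamma>) * deriv f z
              + of_real \<gamma> * z * deriv (deriv f) z - of_real \<beta>)) > 0}"

definition V_transform :: "(real \<Rightarrow> real) \<Rightarrow> (complex \<Rightarrow> complex) \<Rightarrow> complex \<Rightarrow> complex" where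
  "V_transform lam f z =
     (LINT t:{0..1}|lebesgue. of_real (lam t) * (f (of_real t * z) / of_real t))"

text \<open>
  The parameters satisfy \<open>\<mu> + \<nu> = \<alpha> - \<gamma>\<close> and \<open>\<mu> * \<nu> = \<gamma>\<close>; the case \<open>\<gamma> = 0\<close>, in which \<open>\<mu> = 0\<close>
  and \<open>\<nu> = \<alpha>\<close>, has its own formula in each definition.
\<close>

definition g_fun :: "real \<Rightarrow> real \<Rightarrow> real \<Rightarrow> real \<Rightarrow> real \<Rightarrow> real \<Rightarrow> real" where
  "g_fun \<sigma> \<alpha> \<gamma> \<mu> \<nu> t =
     (if \<gamma> > 0 then
        2 / (\<mu> * \<nu>) *
        (LINT w:{0..1}|lebesgue. LINT s:{0..1}|lebesgue.
           (1 - \<sigma> * (1 + s * w * t)) / ((1 - \<sigma>) * (1 + s * w * t) ^ 2)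
             * s powr (1 / \<mu> - 1) * w powr (1 / \<nu> - 1)) - 1
      else
        2 / \<alpha> * t powr (- (1 / \<alpha>)) *
        (LINT s:{0..t}|lebesgue.
           (1 - \<sigma> * (1 + s)) / ((1 - \<sigma>) * (1 + s) ^ 2) * s powr (1 / \<alpha> - 1)) - 1)"

definition q_fun :: "real \<Rightarrow> real \<Rightarrow> real \<Rightarrow> real \<Rightarrow> real \<Rightarrow> real \<Rightarrow> real" where
  "q_fun \<sigma> \<alpha> \<gamma> \<mu> \<nu> t =
     (if \<gamma> > 0 then
        1 / (\<mu> * \<nu>) *
        (LINT w:{0..1}|lebesgue. LINT s:{0..1}|lebesgue.
           (1 - \<sigma> - (1 + \<sigma>) * (s * w * t)) / ((1 - \<sigma>) * (1 + s * w * t) ^ 3)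
             * s powr (1 / \<mu> - 1) * w powr (1 / \<nu> - 1))
      else
        1 / \<alpha> * t powr (- (1 / \<alpha>)) *
        (LINT s:{0..t}|lebesgue.
           (1 - \<sigma> - (1 + \<sigma>) * s) / ((1 - \<sigma>) * (1 + s) ^ 3) * s powr (1 / \<alpha> - 1)))"

definition Lam_fun :: "(real \<Rightarrow> real) \<Rightarrow> real \<Rightarrow> real \<Rightarrow> real" where
  "Lam_fun lam \<nu> t = (LINT x:{t..1}|lebesgue. lam x / x powr (1 / \<nu>))"

definition Pi_fun :: "(real \<Rightarrow> real) \<Rightarrow> real \<Rightarrow> real \<Rightarrow> real \<Rightarrow> real" where
  "Pi_fun lam \<mu> \<nu> t =
     (if \<mu> > 0 then LINT x:{t..1}|lebesgue. Lam_fun lam \<nu> x * x powr (1 / \<nu> - 1 - 1 / \<mu>)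
      else Lam_fun lam \<nu> t)"

definition h_fun :: "real \<Rightarrow> complex \<Rightarrow> complex \<Rightarrow> complex" where
  "h_fun \<sigma> \<epsilon> z =
     z * (1 + (\<epsilon> + of_real (2 * \<sigma> - 1)) / of_real (2 * (1 - \<sigma>)) * z) / (1 - z) ^ 2"

definition L_fun :: "real \<Rightarrow> real \<Rightarrow> complex \<Rightarrow> complex \<Rightarrow> real \<Rightarrow> real" where
  "L_fun \<sigma> \<xi> \<epsilon> z t =
     (1 - \<xi>) * (Re (quot_id (h_fun \<sigma> \<epsilon>) (of_real t * z))
                 - (1 - \<sigma> * (1 + t)) / ((1 - \<sigma>) * (1 + t) ^ 2))
     + \<xi> * (Re (deriv (h_fun \<sigma> \<epsilon>) (of_real t * z))
                 - (1 - \<sigma> - (1 + \<sigma>) * t) / ((1 - \<sigma>) * (1 + t) ^ 3))"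

definition M_fun ::
  "(real \<Rightarrow> real) \<Rightarrow> real \<Rightarrow> real \<Rightarrow> real \<Rightarrow> real \<Rightarrow> real \<Rightarrow> real \<Rightarrow> complex \<Rightarrow> complex \<Rightarrow> real" where
  "M_fun lam \<sigma> \<xi> \<alpha> \<gamma> \<mu> \<nu> \<epsilon> z =
     (if \<gamma> > 0 then
        (LINT t:{0..1}|lebesgue. t powr (1 / \<mu> - 1) * Pi_fun lam \<mu> \<nu> t * L_fun \<sigma> \<xi> \<epsilon> z t)
      else
        (LINT t:{0..1}|lebesgue. t powr (1 / \<alpha> - 1) * Pi_fun lam 0 \<alpha> t * L_fun \<sigma> \<xi> \<epsilon> z t))"

end

theory Submission
  imports Defs "HOL-Real_Asymp.Real_Asymp"
begin

text \<open>
  The idea is to turn all three claims into statements about one family of analytic functions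
  \<open>Psi \<epsilon>\<close> on the disk, indexed by \<open>\<bar>\<epsilon>\<bar> = 1\<close>, and one number \<open>threshold\<close>.

  Put \<open>\<tau>\<^sub>k = \<integral> \<lambda>(t) t\<^sup>k dt\<close>. On Taylor coefficients every operator in sight is diagonal: with \<open>\<theta> = z d/dz\<close> the
  differential operator that defines the class \<open>W\<close> is \<open>(1 + \<mu> \<theta>) (1 + \<nu> \<theta>)\<close> applied to \<open>f(z) / z\<close>, the
  transform multiplies the coefficient of \<open>z\<^sup>k\<close> in \<open>f(z) / z\<close> by \<open>\<tau>\<^sub>k\<close>, and \<open>F \<mapsto> \<xi> z F' + (1 - \<xi>) F\<close>
  multiplies it by \<open>1 + \<xi> k\<close>. Fubini's theorem shows that \<open>t powr (1 / \<mu> - 1) * Pi_fun lam \<mu> \<nu> t\<close>, divided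
  by \<open>\<mu> \<nu>\<close>, is a probability density on the unit interval with moments
  \<open>\<tau>\<^sub>k / ((1 + \<mu> k) (1 + \<nu> k))\<close> (\<open>density_moment\<close>; for \<open>\<gamma> = 0\<close> only one of the two integrations is there).
  Hence \<open>M_fun\<close> equals, up to a positive factor, \<open>Re (Psi \<epsilon> z) - threshold\<close>, where \<open>Psi \<epsilon>\<close> has the
  coefficients \<open>(1 + \<xi> k) ((1 + c) k + 1) \<tau>\<^sub>k / ((1 + \<mu> k) (1 + \<nu> k))\<close> with
  \<open>c = (\<epsilon> + 2 \<sigma> - 1) / (2 (1 - \<sigma>))\<close>, and \<open>threshold\<close> is the limit of \<open>Psi 1 z\<close> as \<open>z \<rightarrow> -1\<close>
  along the radius (\<open>M_fun_eq\<close>, \<open>Psi_boundary_limit\<close>). The equation that determines \<open>\<beta>\<close> says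
  precisely that \<open>threshold = 1 - 1 / (2 (1 - \<beta>))\<close> (\<open>threshold_eq\<close>).

  On the other side, \<open>G = \<xi> z F' + (1 - \<xi>) F\<close> satisfies \<open>Re (z G' / G) > \<sigma>\<close> if and only if
  \<open>(1 + c) z G' - c G\<close> has no zero in the punctured disk for any \<open>\<epsilon>\<close>, because
  \<open>c / (1 + c)\<close> runs through the line \<open>Re w = \<sigma>\<close>, and for \<open>\<epsilon> = -1\<close> the expression is \<open>G\<close> itself (\<open>starlike_convolution_criterion\<close>). For
  \<open>F = V_transform lam f\<close> this expression is \<open>z\<close> times the Hadamard product of \<open>Psi \<epsilon>\<close> with the function
  \<open>H = W_op f\<close>, and \<open>H\<close> is normalised by \<open>H 0 = 1\<close> and maps the disk into a half-plane with \<open>\<beta>\<close> on its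
  boundary (\<open>pascu_convolution\<close>).

  If \<open>Re (Psi \<epsilon>) \<ge> 1 - 1 / (2 (1 - \<beta>))\<close>, a Poisson-type average shows that no such Hadamard product has a
  zero (\<open>half_plane_nonvanishing\<close>). If the inequality fails somewhere, then by continuity equality holds
  at some point, and a suitable Moebius function \<open>H\<close> onto a half-plane makes the product vanish there
  (\<open>extremal_not_in_pascu\<close>). This gives the equivalence. It also gives sharpness: lowering \<open>\<beta>\<close> raises
  \<open>1 - 1 / (2 (1 - \<beta>))\<close> above the limit \<open>threshold\<close> of \<open>Psi 1\<close>, so the inequality fails near \<open>-1\<close>.
  Finally, a function with \<open>Re (z G' / G) > 0\<close> is univalent (\<open>starlike_univalent\<close>), which identifies the
  Pascu condition on \<open>F\<close> with starlikeness of \<open>G\<close>.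
\<close>

section \<open>Power series on the unit disk\<close>

text \<open>
  The coefficient sequence is carried explicitly, so that operators on functions can be read off as
  operations on sequences. Only the values on the open disk are constrained.
\<close>
definition disc_series :: "(nat \<Rightarrow> complex) \<Rightarrow> (complex \<Rightarrow> complex) \<Rightarrow> bool" where
  "disc_series a f \<longleftrightarrow> (\<forall>z\<in>ball 0 1. (\<lambda>n. a n * z ^ n) sums f z)"

lemma disc_seriesD: "disc_series a f \<Longrightarrow> norm z < 1 \<Longrightarrow> (\<lambda>n. a n * z ^ n) sums f z"
  by (simp add: disc_series_def)

lemma disc_series_exists:
  assumes "f holomorphic_on ball 0 1"
  shows "\<exists>a. disc_series a f"
  using holomorphic_power_series[OF assms] unfolding disc_series_def
  by (intro exI[of _ "\<lambda>n. (deriv ^^ n) f 0 / fact n"]) simp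

lemma disc_series_holomorphic: "disc_series a f \<Longrightarrow> f holomorphic_on ball 0 1"
  unfolding disc_series_def by (rule power_series_holomorphic[where a = a]) simp

lemma disc_series_0: "disc_series a f \<Longrightarrow> f 0 = a 0"
  using disc_seriesD[of a f 0] by (simp add: sums_iff)

lemma disc_series_cong:
  "disc_series a f \<Longrightarrow> (\<And>n. a n = b n) \<Longrightarrow> (\<And>z. norm z < 1 \<Longrightarrow> f z = g z) \<Longrightarrow> disc_series b g"
  by (simp add: disc_series_def)

lemma disc_series_add:
  "disc_series a f \<Longrightarrow> disc_series b g \<Longrightarrow> disc_series (\<lambda>n. a n + b n) (\<lambda>z. f z + g z)"
  by (auto simp: disc_series_def distrib_right intro: sums_add)

lemma disc_series_cmult: "disc_series a f \<Longrightarrow> disc_series (\<lambda>n. c * a n) (\<lambda>z. c * f z)"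
  by (auto simp: disc_series_def mult.assoc intro: sums_mult)

lemma disc_series_const: "disc_series (\<lambda>k. if k = 0 then c else 0) (\<lambda>z. c)"
  using sums_single[of 0 "\<lambda>k. c * _ ^ k"]
  by (auto simp: disc_series_def if_distrib[of "\<lambda>x. x * _"] cong: if_cong)

lemma disc_series_geometric: "disc_series (\<lambda>_. 1) (\<lambda>w. 1 / (1 - w))"
  by (auto simp: disc_series_def geometric_sums)

lemma disc_series_has_derivative:
  assumes "disc_series a f" "norm z < 1"
  shows "(\<lambda>n. diffs a n * z ^ n) sums deriv f z"
proof (rule termdiffs_sums_strong)
  show "\<And>z. cmod z < 1 \<Longrightarrow> (\<lambda>n. a n * z ^ n) sums f z"
    using assms(1) by (rule disc_seriesD)
  show "(f has_field_derivative deriv f z) (at z)"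
    using assms by (intro holomorphic_derivI[OF disc_series_holomorphic[OF assms(1)]]) auto
qed fact

lemma disc_series_deriv:
  "disc_series a f \<Longrightarrow> disc_series (\<lambda>n. of_nat (Suc n) * a (Suc n)) (deriv f)"
  unfolding disc_series_def
  using disc_series_has_derivative[unfolded disc_series_def] by (auto simp: diffs_def)

lemma disc_series_shift:
  assumes "disc_series a f"
  shows "disc_series (\<lambda>n. case n of 0 \<Rightarrow> 0 | Suc k \<Rightarrow> a k) (\<lambda>z. z * f z)"
  unfolding disc_series_def
proof
  fix z :: complex assume "z \<in> ball 0 1"
  then have "(\<lambda>n. z * (a n * z ^ n)) sums (z * f z)"
    using assms by (intro sums_mult disc_seriesD) auto
  then have "(\<lambda>n. (case Suc n of 0 \<Rightarrow> 0 | Suc k \<Rightarrow> a k) * z ^ Suc n) sums (z * f z)"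
    by (simp add: mult_ac)
  from sums_Suc[OF this] 
  show "(\<lambda>n. (case n of 0 \<Rightarrow> 0 | Suc k \<Rightarrow> a k) * z ^ n) sums (z * f z)"
    by simp
qed

lemma disc_series_euler:
  assumes "disc_series a f"
  shows "disc_series (\<lambda>n. of_nat n * a n) (\<lambda>z. z * deriv f z)"
  by (rule disc_series_cong[OF disc_series_shift[OF disc_series_deriv[OF assms]]])
     (auto split: nat.splits)

lemma disc_series_unique:
  assumes "disc_series a f" "disc_series b g" "\<And>z. norm z < 1 \<Longrightarrow> f z = g z"
  shows "a = b"
proof -
  have *: "a n = (deriv ^^ n) f 0 / fact n" if "disc_series a f" for a n f
    using that
  proof (induction n arbitrary: a f)
    case 0 then show ?case by (simp add: disc_series_0)
  next
    case (Suc n)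
    then have "of_nat (Suc n) * a (Suc n) = (deriv ^^ n) (deriv f) 0 / fact n"
      using disc_series_deriv by blast
    then have "a (Suc n) = (deriv ^^ n) (deriv f) 0 / (of_nat (Suc n) * fact n)"
      by (simp add: field_simps del: of_nat_Suc)
    then show ?case
      by (simp add: funpow_Suc_right del: funpow.simps)
  qed
  have "disc_series b f" using assms by (auto simp: disc_series_def)
  then show ?thesis using *[OF assms(1)] * by (intro ext) metis
qed

lemma disc_series_quot_id:
  assumes "disc_series a f" "a 0 = 0"
  shows "disc_series (\<lambda>n. a (Suc n)) (quot_id f)"
  unfolding disc_series_def
proof
  fix z :: complex assume z: "z \<in> ball 0 1"
  show "(\<lambda>n. a (Suc n) * z ^ n) sums quot_id f z"
  proof (cases "z = 0")
    case True
    then show ?thesis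
      using disc_series_0[OF disc_series_deriv[OF assms(1)]] by (simp add: quot_id_def)
  next
    case False
    have "(\<lambda>n. a (Suc n) * z ^ Suc n) sums f z"
      using disc_seriesD[OF assms(1), of z] z assms(2) by (subst sums_Suc_iff) simp
    then have "(\<lambda>n. a (Suc n) * z ^ Suc n / z) sums (f z / z)"
      by (rule sums_divide)
    then show ?thesis using False by (simp add: quot_id_def)
  qed
qed

lemma disc_series_bounded:
  assumes "\<And>n. norm (a n) \<le> B"
  shows "disc_series a (\<lambda>z. \<Sum>n. a n * z ^ n)"
  unfolding disc_series_def
proof
  fix z :: complex assume "z \<in> ball 0 1"
  then have "summable (\<lambda>n. B * norm z ^ n)"
    by (intro summable_mult summable_geometric) auto
  then have "summable (\<lambda>n. a n * z ^ n)"
    by (rule summable_comparison_test') (auto simp: norm_mult norm_power intro!: mult_right_mono assms)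
  then show "(\<lambda>n. a n * z ^ n) sums (\<Sum>n. a n * z ^ n)" by (rule summable_sums)
qed

lemma disc_series_abs_summable:
  fixes z :: complex
  assumes "disc_series a f" "norm z < 1"
  shows "summable (\<lambda>n. norm (a n) * norm z ^ n)"
proof -
  obtain r where r: "norm z < r" "r < 1" using assms(2) dense by blast
  have "norm (of_real r :: complex) < 1"
    using r norm_ge_zero[of z] unfolding norm_of_real by linarith
  then have "summable (\<lambda>n. a n * of_real r ^ n)"
    by (intro sums_summable[OF disc_seriesD[OF assms(1)]])
  moreover have "norm z < norm (of_real r :: complex)" using r by simp
  ultimately have "summable (\<lambda>n. norm (a n * z ^ n))" by (rule powser_insidea)
  then show ?thesis by (simp add: norm_mult norm_power)
qed

text \<open>
  Averaging \<open>f\<close> over dilations and rotations \<open>z \<mapsto> \<zeta> z\<close> of the disk multiplies the coefficients by the moments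
  of \<open>\<zeta>\<close>. The interchange of sum and integral is dominated by \<open>\<Sum>\<bar>a\<^sub>k\<bar> \<bar>z\<bar>\<^sup>k\<close>. It is used on
  the circle, where the moments are Fourier coefficients, and on the interval \<open>[0, 1]\<close>.
\<close>
lemma disc_series_integral:
  fixes w \<zeta> :: "'a \<Rightarrow> complex"
  assumes f: "disc_series a f" and z: "norm z < 1"
    and w: "set_integrable M S w" and \<zeta> [measurable]: "\<zeta> \<in> borel_measurable M"
    and le: "\<And>t. t \<in> S \<Longrightarrow> norm (\<zeta> t) \<le> 1"
  shows "set_integrable M S (\<lambda>t. w t * f (\<zeta> t * z))"
    and "(\<lambda>k. a k * (LINT t:S|M. w t * \<zeta> t ^ k) * z ^ k) sums (LINT t:S|M. w t * f (\<zeta> t * z))"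
proof -
  define v where "v t = indicator S t *\<^sub>R w t" for t
  have v: "integrable M v" using w by (simp add: v_def[abs_def] set_integrable_def)
  then have [measurable]: "v \<in> borel_measurable M" by auto
  have vle: "norm (v t * \<zeta> t ^ k) \<le> norm (v t)" for t k
    using le[of t] by (cases "t \<in> S") (auto simp: v_def norm_mult norm_power power_le_one mult_left_le)
  have vk: "integrable M (\<lambda>t. v t * \<zeta> t ^ k)" for k
    by (rule Bochner_Integration.integrable_bound[OF v]) (use vle in auto)
  define u where "u k t = v t * \<zeta> t ^ k * (a k * z ^ k)" for k t
  have u: "integrable M (u k)" for k
    unfolding u_def by (intro integrable_mult_left vk)
  have us: "u k t = indicator S t *\<^sub>R (w t * (a k * (\<zeta> t * z) ^ k))" for k t
    by (simp add: u_def v_def power_mult_distrib)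
  have ub: "norm (u k t) \<le> norm (v t) * (norm (a k) * norm z ^ k)" for k t
    unfolding u_def norm_mult[of _ "a k * z ^ k"] using vle[of t k]
    by (auto simp: norm_mult norm_power intro!: mult_right_mono)
  have sm: "summable (\<lambda>k. norm (a k) * norm z ^ k)" by (rule disc_series_abs_summable[OF f z])
  have s1: "AE t in M. summable (\<lambda>k. norm (u k t))"
    by (intro AE_I2 summable_comparison_test'[OF summable_mult[OF sm]]) (use ub in auto)
  have s2: "summable (\<lambda>k. \<integral>t. norm (u k t) \<partial>M)"
  proof (rule summable_comparison_test'[OF summable_mult[OF sm, of "\<integral>t. norm (v t) \<partial>M"]])
    fix k
    have "(\<integral>t. norm (u k t) \<partial>M) \<le> (\<integral>t. norm (v t) * (norm (a k) * norm z ^ k) \<partial>M)"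
      by (intro integral_mono integrable_norm u integrable_mult_left v ub)
    then show "norm (\<integral>t. norm (u k t) \<partial>M) \<le> (\<integral>t. norm (v t) \<partial>M) * (norm (a k) * norm z ^ k)"
      by simp
  qed
  have eq: "(\<Sum>k. u k t) = indicator S t *\<^sub>R (w t * f (\<zeta> t * z))" for t
  proof (cases "t \<in> S")
    case True
    have "norm (\<zeta> t * z) \<le> 1 * norm z"
      unfolding norm_mult using le[OF True] by (intro mult_right_mono) auto
    then have "(\<lambda>k. a k * (\<zeta> t * z) ^ k) sums f (\<zeta> t * z)"
      using z by (intro disc_seriesD[OF f]) simp
    then have "(\<lambda>k. w t * (a k * (\<zeta> t * z) ^ k)) sums (w t * f (\<zeta> t * z))" by (rule sums_mult)
    then show ?thesis using True by (simp add: us sums_iff)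
  qed (simp add: us)
  have "integrable M (\<lambda>t. \<Sum>k. u k t)" by (rule integrable_suminf[OF u s1 s2])
  then show "set_integrable M S (\<lambda>t. w t * f (\<zeta> t * z))"
    unfolding eq set_integrable_def .
  have "(\<lambda>k. integral\<^sup>L M (u k)) sums (\<integral>t. (\<Sum>k. u k t) \<partial>M)" by (rule sums_integral[OF u s1 s2])
  also have "(\<integral>t. (\<Sum>k. u k t) \<partial>M) = (LINT t:S|M. w t * f (\<zeta> t * z))"
    by (simp add: eq set_lebesgue_integral_def)
  also have "(\<lambda>k. integral\<^sup>L M (u k)) = (\<lambda>k. a k * (LINT t:S|M. w t * \<zeta> t ^ k) * z ^ k)"
  proof
    fix k
    have "integral\<^sup>L M (u k) = (\<integral>t. v t * \<zeta> t ^ k \<partial>M) * (a k * z ^ k)"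
      unfolding u_def by simp
    also have "(\<integral>t. v t * \<zeta> t ^ k \<partial>M) = (LINT t:S|M. w t * \<zeta> t ^ k)"
      by (simp add: v_def set_lebesgue_integral_def)
    finally show "integral\<^sup>L M (u k) = a k * (LINT t:S|M. w t * \<zeta> t ^ k) * z ^ k"
      by (simp add: mult_ac)
  qed
  finally show "(\<lambda>k. a k * (LINT t:S|M. w t * \<zeta> t ^ k) * z ^ k) sums (LINT t:S|M. w t * f (\<zeta> t * z))" .
qed

section \<open>Hadamard products with functions into a half-plane\<close>

lemma integral_cis:
  "(LINT \<theta>:{0..2*pi}|lborel. cis (of_int m * \<theta>)) = (if m = 0 then 2 * complex_of_real pi else 0)"
proof (cases "m = 0")
  case True
  have "(LINT \<theta>:{0..2*pi}|lborel. 1) = 2 * complex_of_real pi"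
    unfolding set_lebesgue_integral_def by (simp add: scaleR_conv_of_real)
  then show ?thesis using True by (simp flip: one_complex.code add: cis_zero)
next
  case False
  define F where "F \<theta> = cis (of_int m * \<theta>) / (\<i> * of_int m)" for \<theta> :: real
  have "(F has_vector_derivative cis (of_int m * \<theta>)) (at \<theta> within {0..2*pi})" for \<theta>
  proof -
    have "((\<lambda>w. exp (\<i> * (of_int m * w)) / (\<i> * of_int m)) has_field_derivative cis (of_int m * \<theta>))
            (at (of_real \<theta>))"
      using False by (auto intro!: derivative_eq_intros simp: cis_conv_exp mult_ac)
    from has_vector_derivative_real_field[OF this]
    show ?thesis by (simp add: F_def[abs_def] cis_conv_exp)
  qed
  then have "(LINT \<theta>:{0..2*pi}|lborel. cis (of_int m * \<theta>)) = F (2*pi) - F 0"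
    unfolding set_lebesgue_integral_def
    by (intro integral_FTC_atLeastAtMost continuous_intros) auto
  also have "cis (of_int m * (2*pi)) = 1"
    by (metis cis_multiple_2pi Ints_of_int mult.commute)
  then have "F (2*pi) - F 0 = 0" by (simp add: F_def)
  finally show ?thesis using False by simp
qed

lemma disc_series_circle_continuous:
  assumes "disc_series a f" "0 \<le> r" "r < 1"
  shows "continuous_on UNIV (\<lambda>\<theta>. f (of_real r * cis \<theta>))"
proof -
  have "continuous_on (ball 0 1) f"
    using disc_series_holomorphic[OF assms(1)] by (rule holomorphic_on_imp_continuous_on)
  moreover have "(\<lambda>\<theta>. of_real r * cis \<theta>) ` UNIV \<subseteq> ball 0 1"
    using assms by (auto simp: norm_mult)
  ultimately show ?thesis
    by (intro continuous_on_compose2[of "ball 0 1" f UNIV]) (auto intro!: continuous_intros)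
qed

text \<open>
  For \<open>k \<le> 0\<close> this is Cauchy's coefficient formula; for \<open>k > 0\<close> the integral vanishes since \<open>P\<close> has no
  terms of negative degree.
\<close>
lemma coefficient_integral:
  assumes P: "disc_series q P" and r: "0 \<le> r" "r < 1"
  shows "(LINT \<theta>:{0..2*pi}|lborel. cis (of_int k * \<theta>) * P (of_real r * cis \<theta>))
           = (if k \<le> 0 then 2 * of_real pi * q (nat (-k)) * of_real r ^ nat (-k) else 0)" (is "?I = ?R")
proof -
  have "(\<lambda>n. q n * (LINT \<theta>:{0..2*pi}|lborel. cis (of_int k * \<theta>) * cis \<theta> ^ n) * of_real r ^ n) sums
      (LINT \<theta>:{0..2*pi}|lborel. cis (of_int k * \<theta>) * P (cis \<theta> * of_real r))"
  proof (rule disc_series_integral(2)[OF P])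
    show "norm (of_real r :: complex) < 1" using r by simp
    show "set_integrable lborel {0..2*pi} (\<lambda>\<theta>. cis (of_int k * \<theta>))"
      by (intro borel_integrable_atLeastAtMost' continuous_intros)
    show "cis \<in> borel_measurable lborel"
      by (simp, intro borel_measurable_continuous_onI continuous_intros)
  qed simp
  also have "(\<lambda>n. q n * (LINT \<theta>:{0..2*pi}|lborel. cis (of_int k * \<theta>) * cis \<theta> ^ n) * of_real r ^ n)
      = (\<lambda>n. if n = nat (-k) then ?R else 0)"
  proof
    fix n
    have "cis (of_int k * \<theta>) * cis \<theta> ^ n = cis (of_int (k + int n) * \<theta>)" for \<theta>
      unfolding Complex.DeMoivre cis_mult by (simp add: algebra_simps)
    then have "(LINT \<theta>:{0..2*pi}|lborel. cis (of_int k * \<theta>) * cis \<theta> ^ n)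
        = (if k + int n = 0 then 2 * complex_of_real pi else 0)"
      by (simp only: integral_cis)
    then show "q n * (LINT \<theta>:{0..2*pi}|lborel. cis (of_int k * \<theta>) * cis \<theta> ^ n) * of_real r ^ n
      = (if n = nat (-k) then ?R else 0)"
      by auto
  qed
  finally have "(\<lambda>n. if n = nat (-k) then ?R else 0) sums
     (LINT \<theta>:{0..2*pi}|lborel. cis (of_int k * \<theta>) * P (cis \<theta> * of_real r))" .
  with sums_single[of "nat (-k)" "\<lambda>_. ?R"] show ?thesis
    by (simp add: sums_unique2 mult.commute)
qed

text \<open>
  The Hadamard product is a weighted mean of values of \<open>\<Psi>\<close>: up to the factor \<open>2 \<pi>\<close> it equals
  \<open>\<integral> (2 Re P(r e\<^sup>i\<^sup>\<theta>) - 1) \<Psi>(e\<^sup>-\<^sup>i\<^sup>\<theta> z / r) d\<theta>\<close>, and the hypothesis on \<open>P\<close> makes the weight nonnegative with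
  mean \<open>1\<close>. So every half-plane that contains the range of \<open>\<Psi>\<close> contains the range of the product.
\<close>
lemma convolution_half_plane:
  assumes P: "disc_series q P" "q 0 = 1" "\<And>z. norm z < 1 \<Longrightarrow> 1/2 \<le> Re (P z)"
    and \<Psi>: "disc_series A \<Psi>" "\<And>z. norm z < 1 \<Longrightarrow> K \<le> Re (\<Psi> z)"
    and E: "disc_series (\<lambda>k. q k * A k) E" and z: "norm z < 1"
  shows "K \<le> Re (E z)"
proof -
  obtain r where r: "norm z < r" "r < 1" using z dense by blast
  then have r0: "0 < r" using norm_ge_zero[of z] by linarith
  \<comment> \<open>the Poisson-type weight, nonnegative because \<open>Re P \<ge> 1/2\<close>\<close>
  define w where "w \<theta> = 2 * Re (P (of_real r * cis \<theta>)) - 1" for \<theta>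
  have norm_r: "norm (of_real r * cis \<theta>) < 1" for \<theta> using r r0 by (simp add: norm_mult)
  have w0: "0 \<le> w \<theta>" for \<theta> using P(3)[OF norm_r[of \<theta>]] by (simp add: w_def)
  have cont: "continuous_on UNIV (\<lambda>\<theta>. P (of_real r * cis \<theta>))"
    using disc_series_circle_continuous[OF P(1)] r r0 by simp
  then have cont': "continuous_on {0..2*pi} (\<lambda>\<theta>. P (of_real r * cis \<theta>))"
    by (rule continuous_on_subset) auto
  have cw: "continuous_on {0..2*pi} w"
    unfolding w_def[abs_def] by (intro continuous_intros cont')
  have wint: "set_integrable lborel {0..2*pi} w" by (rule borel_integrable_atLeastAtMost'[OF cw])
  have wcint: "set_integrable lborel {0..2*pi} (\<lambda>\<theta>. complex_of_real (w \<theta>))"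
    by (intro borel_integrable_atLeastAtMost' continuous_intros cw)
  have mom: "(LINT \<theta>:{0..2*pi}|lborel. complex_of_real (w \<theta>) * cis (-\<theta>) ^ k)
     = 2 * of_real pi * q k * of_real r ^ k" for k
  proof -
    let ?P = "\<lambda>\<theta>. P (of_real r * cis \<theta>)"
    have i1: "set_integrable lborel {0..2*pi} (\<lambda>\<theta>. cis (of_int j * \<theta>) * ?P \<theta>)" for j
      by (intro borel_integrable_atLeastAtMost' continuous_intros cont')
    have i2: "set_integrable lborel {0..2*pi} (\<lambda>\<theta>. cnj (cis (of_int (int k) * \<theta>) * ?P \<theta>))"
      by (intro borel_integrable_atLeastAtMost' continuous_intros cont')
    have i3: "set_integrable lborel {0..2*pi} (\<lambda>\<theta>. cis (of_int j * \<theta>))" for j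
      by (intro borel_integrable_atLeastAtMost' continuous_intros)
    have "complex_of_real (w \<theta>) * cis (-\<theta>) ^ k =
        cis (of_int (- int k) * \<theta>) * ?P \<theta> + cnj (cis (of_int (int k) * \<theta>) * ?P \<theta>)
         - cis (of_int (- int k) * \<theta>)" for \<theta>
    proof -
      \<comment> \<open>the conjugate part and the constant \<open>1\<close> contribute only at \<open>k = 0\<close>, where they cancel\<close>
      have "complex_of_real (w \<theta>) = ?P \<theta> + cnj (?P \<theta>) - 1"
        by (simp add: w_def complex_eq_iff)
      moreover have "cis (-\<theta>) ^ k = cis (of_int (- int k) * \<theta>)"
        unfolding Complex.DeMoivre by simp
      moreover have "cnj (cis (of_int (int k) * \<theta>)) = cis (of_int (- int k) * \<theta>)"
        by (simp add: cis_cnj)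
      ultimately show ?thesis by (simp only: complex_cnj_mult) (simp only: algebra_simps mult_1_left)
    qed
    then have "(LINT \<theta>:{0..2*pi}|lborel. complex_of_real (w \<theta>) * cis (-\<theta>) ^ k)
      = (LINT \<theta>:{0..2*pi}|lborel. cis (of_int (- int k) * \<theta>) * ?P \<theta>)
       + (LINT \<theta>:{0..2*pi}|lborel. cnj (cis (of_int (int k) * \<theta>) * ?P \<theta>))
       - (LINT \<theta>:{0..2*pi}|lborel. cis (of_int (- int k) * \<theta>))"
      by (simp only: set_integral_diff(2)[OF set_integral_add(1)[OF i1 i2] i3] set_integral_add(2)[OF i1 i2])
    also have "(LINT \<theta>:{0..2*pi}|lborel. cnj (cis (of_int (int k) * \<theta>) * ?P \<theta>))
      = cnj (LINT \<theta>:{0..2*pi}|lborel. cis (of_int (int k) * \<theta>) * ?P \<theta>)"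
    proof -
      have "indicator {0..2*pi} \<theta> *\<^sub>R cnj (cis (of_int (int k) * \<theta>) * ?P \<theta>) =
        cnj (indicator {0..2*pi} \<theta> *\<^sub>R (cis (of_int (int k) * \<theta>) * ?P \<theta>))" for \<theta>
        by (simp add: scaleR_conv_of_real)
      then show ?thesis unfolding set_lebesgue_integral_def by (simp only: Bochner_Integration.integral_cnj)
    qed
    finally show ?thesis
      using r r0 P(2) by (simp add: integral_cis coefficient_integral[OF P(1)] del: of_int_minus of_int_of_nat_eq)
  qed
  define z' where "z' = z / of_real r"
  have z': "norm z' < 1" "z = of_real r * z'" using r r0 by (auto simp: z'_def norm_divide)
  have m: "(\<lambda>\<theta>. cis (-\<theta>)) \<in> borel_measurable lborel"
    by (simp, intro borel_measurable_continuous_onI continuous_intros)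
  note I = disc_series_integral[OF \<Psi>(1) z'(1) wcint m]
  have \<Psi>int: "set_integrable lborel {0..2*pi} (\<lambda>\<theta>. complex_of_real (w \<theta>) * \<Psi> (cis (-\<theta>) * z'))"
    by (rule I(1)) simp
  have "(\<lambda>k. A k * (2 * of_real pi * q k * of_real r ^ k) * z' ^ k) sums
      (LINT \<theta>:{0..2*pi}|lborel. complex_of_real (w \<theta>) * \<Psi> (cis (-\<theta>) * z'))"
    using I(2) by (simp add: mom)
  moreover have "(\<lambda>k. A k * (2 * of_real pi * q k * of_real r ^ k) * z' ^ k) sums (2 * of_real pi * E z)"
    using sums_mult[OF disc_seriesD[OF E z], of "2 * of_real pi"]
    by (simp add: z'(2) power_mult_distrib mult_ac)
  ultimately have eq: "2 * of_real pi * E z =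
      (LINT \<theta>:{0..2*pi}|lborel. complex_of_real (w \<theta>) * \<Psi> (cis (-\<theta>) * z'))"
    by (rule sums_unique2[rotated])
  have int_w: "(LINT \<theta>:{0..2*pi}|lborel. w \<theta>) = 2 * pi"
  proof -
    have "complex_of_real (LINT \<theta>:{0..2*pi}|lborel. w \<theta>) = of_real (2 * pi)"
      using mom[of 0] P(2) by (simp add: set_integral_complex_of_real)
    then show ?thesis by (simp only: of_real_eq_iff)
  qed
  have "K * (2 * pi) = (LINT \<theta>:{0..2*pi}|lborel. K * w \<theta>)" by (simp add: int_w)
  also have "\<dots> \<le> (LINT \<theta>:{0..2*pi}|lborel. Re (complex_of_real (w \<theta>) * \<Psi> (cis (-\<theta>) * z')))"
  proof (rule set_integral_mono)
    show "set_integrable lborel {0..2*pi} (\<lambda>\<theta>. K * w \<theta>)" using wint by simp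
    show "set_integrable lborel {0..2*pi} (\<lambda>\<theta>. Re (complex_of_real (w \<theta>) * \<Psi> (cis (-\<theta>) * z')))"
      using integrable_Re[OF \<Psi>int[unfolded set_integrable_def]] by (simp add: set_integrable_def)
    fix \<theta> :: real
    have "K \<le> Re (\<Psi> (cis (-\<theta>) * z'))" by (rule \<Psi>(2)) (simp add: norm_mult z')
    from mult_right_mono[OF this w0[of \<theta>]]
    show "K * w \<theta> \<le> Re (complex_of_real (w \<theta>) * \<Psi> (cis (-\<theta>) * z'))"
      by (simp add: mult.commute)
  qed
  also have "\<dots> = Re (LINT \<theta>:{0..2*pi}|lborel. complex_of_real (w \<theta>) * \<Psi> (cis (-\<theta>) * z'))"
    using integral_Re[OF \<Psi>int[unfolded set_integrable_def]] by (simp add: set_lebesgue_integral_def)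
  also have "\<dots> = Re (E z) * (2 * pi)" by (simp add: eq[symmetric])
  finally show ?thesis by simp
qed

text \<open>
  A function with real part at least \<open>K\<close> that attains \<open>K\<close> is constant, by the maximum modulus principle
  for \<open>exp (- f)\<close>.
\<close>
lemma Re_gt_of_Re_ge:
  assumes hol: "f holomorphic_on ball 0 1" and ge: "\<And>z. norm z < 1 \<Longrightarrow> K \<le> Re (f z)"
    and f0: "K < Re (f 0)" and z: "norm z < 1"
  shows "K < Re (f z)"
proof (rule ccontr)
  assume "\<not> K < Re (f z)"
  then have "Re (f z) = K" using ge[OF z] by simp
  then have max: "norm (exp (- f w)) \<le> norm (exp (- f z))" if "w \<in> ball 0 1" for w
    using ge that by simp
  have "(\<lambda>w. exp (- f w)) constant_on ball 0 1"
    by (rule maximum_modulus_principle[of _ _ "ball 0 1" z]) (use hol max z in \<open>auto intro!: holomorphic_intros\<close>)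
  then have "exp (- f 0) = exp (- f z)" using z by (auto simp: constant_on_def)
  then have "Re (f 0) = Re (f z)" by (metis norm_exp_eq_Re exp_inj_iff uminus_complex.sel(1) neg_equal_iff_equal)
  then show False using f0 \<open>Re (f z) = K\<close> by simp
qed

text \<open>
  An affine change of variable moves the half-plane that contains the range of \<open>H\<close> to \<open>Re w > 1/2\<close> and fixes
  \<open>1 = H 0\<close>. It commutes with the Hadamard product because both factors have constant term \<open>1\<close>. A zero of \<open>Q\<close>
  would be moved to a point on the line \<open>Re w = 1 - 1 / (2 (1 - \<beta>))\<close>, which bounds the range of \<open>\<Psi>\<close>.
\<close>
lemma half_plane_nonvanishing:
  assumes H: "disc_series b H" "b 0 = 1" and \<beta>: "\<beta> < 1"
    and pos: "\<And>z. norm z < 1 \<Longrightarrow> 0 < Re (cis \<phi> * (H z - of_real \<beta>))"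
    and \<Psi>: "disc_series A \<Psi>" "A 0 = 1" "\<And>z. norm z < 1 \<Longrightarrow> 1 - 1 / (2 * (1 - \<beta>)) \<le> Re (\<Psi> z)"
    and Q: "disc_series (\<lambda>k. b k * A k) Q" and z: "norm z < 1"
  shows "Q z \<noteq> 0"
proof
  assume Qz: "Q z = 0"
  have "H 0 = 1" using disc_series_0[OF H(1)] H(2) by simp
  then have "cos \<phi> * (1 - \<beta>) > 0" using pos[of 0] by simp
  then have c: "cos \<phi> > 0" using \<beta> by (simp add: zero_less_mult_iff)
  \<comment> \<open>the slope of that affine map; its real part does not depend on \<open>\<phi>\<close>\<close>
  define \<kappa> where "\<kappa> = cis \<phi> / of_real (2 * (1 - \<beta>) * cos \<phi>)"
  have \<kappa>0: "\<kappa> \<noteq> 0" using c \<beta> by (simp add: \<kappa>_def)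
  have Re\<kappa>: "Re \<kappa> = 1 / (2 * (1 - \<beta>))" using c \<beta> by (simp add: \<kappa>_def Re_divide_of_real)
  define q where "q k = (if k = 0 then 1 else \<kappa> * b k)" for k
  have P: "disc_series q (\<lambda>z. \<kappa> * H z + (1 - \<kappa>))"
    by (rule disc_series_cong[OF disc_series_add[OF disc_series_cmult[OF H(1), of \<kappa>] disc_series_const]])
       (auto simp: q_def H)
  have E: "disc_series (\<lambda>k. q k * A k) (\<lambda>z. \<kappa> * Q z + (1 - \<kappa>))"
    by (rule disc_series_cong[OF disc_series_add[OF disc_series_cmult[OF Q, of \<kappa>] disc_series_const]])
       (auto simp: q_def H \<Psi>)
  have "1/2 \<le> Re (\<kappa> * H w + (1 - \<kappa>))" if w: "norm w < 1" for w
  proof -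
    have "\<kappa> * H w + (1 - \<kappa>) = cis \<phi> * (H w - of_real \<beta>) / of_real (2 * (1 - \<beta>) * cos \<phi>) + (1 - of_real (1 - \<beta>) * \<kappa>)"
      using c \<beta> by (simp add: \<kappa>_def field_simps)
    then have "Re (\<kappa> * H w + (1 - \<kappa>)) =
        Re (cis \<phi> * (H w - of_real \<beta>) / of_real (2 * (1 - \<beta>) * cos \<phi>)) + (1 - Re (of_real (1 - \<beta>) * \<kappa>))"
      by (simp only: plus_complex.sel minus_complex.sel one_complex.sel)
    moreover have "Re (of_real (1 - \<beta>) * \<kappa>) = 1/2"
      using \<beta> by (simp add: Re\<kappa> flip: of_real_diff)
    moreover have "0 \<le> Re (cis \<phi> * (H w - of_real \<beta>) / of_real (2 * (1 - \<beta>) * cos \<phi>))"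
      unfolding Re_divide_of_real using pos[OF w] c \<beta> by (intro divide_nonneg_nonneg) auto
    ultimately show ?thesis by linarith
  qed
  then have ge: "1 - 1 / (2 * (1 - \<beta>)) \<le> Re (\<kappa> * Q w + (1 - \<kappa>))" if "norm w < 1" for w
    using convolution_half_plane[OF P _ _ \<Psi>(1,3) E that] by (simp add: q_def)
  have "1 - 1 / (2 * (1 - \<beta>)) < Re (\<kappa> * Q z + (1 - \<kappa>))"
  proof (rule Re_gt_of_Re_ge[OF disc_series_holomorphic[OF E] ge _ z])
    show "1 - 1 / (2 * (1 - \<beta>)) < Re (\<kappa> * Q 0 + (1 - \<kappa>))"
      using disc_series_0[OF Q] H(2) \<Psi>(2) \<beta> by simp
  qed
  then show False by (simp add: Qz Re\<kappa>)
qed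

section \<open>Starlike functions\<close>

text \<open>
  Along the segment from \<open>x\<close> to \<open>y\<close> the component of \<open>K\<close> in the direction \<open>y - x\<close> is strictly increasing.
\<close>
lemma Noshiro_Warschawski:
  assumes S: "convex S" "open S"
    and K: "\<And>z. z \<in> S \<Longrightarrow> (K has_field_derivative K' z) (at z)"
    and pos: "\<And>z. z \<in> S \<Longrightarrow> 0 < Re (K' z)"
  shows "inj_on K S"
proof (rule inj_onI, rule ccontr)
  fix x y assume xy: "x \<in> S" "y \<in> S" "K x = K y" "x \<noteq> y"
  define d where "d = y - x"
  define \<phi> where "\<phi> t = Re (cnj d * K (x + of_real t * d))" for t :: real
  have "\<phi> 0 < \<phi> 1"
  proof (rule DERIV_pos_imp_increasing[of 0 1 \<phi>])
    show "(0::real) < 1" by simp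
    fix t :: real assume t: "0 \<le> t" "t \<le> 1"
    have "x + of_real t * d = (1 - t) *\<^sub>R x + t *\<^sub>R y"
      by (simp add: d_def scaleR_conv_of_real algebra_simps)
    then have mem: "x + of_real t * d \<in> S"
      using convexD_alt[OF S(1) xy(1,2)] t by simp
    have "((\<lambda>w. x + w * d) has_field_derivative d) (at (of_real t))"
      by (auto intro!: derivative_eq_intros)
    from DERIV_chain2[OF K[OF mem] this]
    have "((\<lambda>w. cnj d * K (x + w * d)) has_field_derivative cnj d * (K' (x + of_real t * d) * d)) (at (of_real t))"
      by (rule DERIV_cmult)
    from has_vector_derivative_real_field[OF this]
    have "((\<lambda>t. cnj d * K (x + of_real t * d)) has_vector_derivative cnj d * (K' (x + of_real t * d) * d)) (at t)" .
    then have "(\<phi> has_real_derivative Re (cnj d * (K' (x + of_real t * d) * d))) (at t)"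
      unfolding \<phi>_def[abs_def] has_real_derivative_iff_has_vector_derivative
      by (rule bounded_linear.has_vector_derivative[OF bounded_linear_Re])
    moreover have "cnj d * (K' (x + of_real t * d) * d) = of_real ((norm d)\<^sup>2) * K' (x + of_real t * d)"
      unfolding complex_norm_square by (simp add: mult_ac)
    then have "Re (cnj d * (K' (x + of_real t * d) * d)) = Re (of_real ((norm d)\<^sup>2) * K' (x + of_real t * d))"
      by (rule arg_cong)
    then have "Re (cnj d * (K' (x + of_real t * d) * d)) = (norm d)\<^sup>2 * Re (K' (x + of_real t * d))"
      by (subst (asm) times_complex.sel(1)) (simp del: of_real_power times_complex.sel)
    moreover have "\<dots> > 0" using pos[OF mem] xy(4) by (intro mult_pos_pos) (auto simp: d_def)
    ultimately show "\<exists>D. (\<phi> has_real_derivative D) (at t) \<and> 0 < D" by metis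
  qed
  moreover have "\<phi> 0 = \<phi> 1" using xy(3) by (simp add: \<phi>_def d_def)
  ultimately show False by simp
qed

lemma quot_id_holomorphic:
  assumes "f holomorphic_on ball 0 1" "f 0 = 0"
  shows "quot_id f holomorphic_on ball 0 1"
proof -
  obtain a where "disc_series a f" using disc_series_exists[OF assms(1)] by blast
  then show ?thesis
    using disc_series_quot_id disc_series_0 assms(2) disc_series_holomorphic by metis
qed

lemma mult_quot_id: "f 0 = 0 \<Longrightarrow> z * quot_id f z = f z"
  by (simp add: quot_id_def)

text \<open>
  In the logarithmic coordinate \<open>z = exp \<zeta>\<close> the function becomes \<open>G (exp \<zeta>) = exp (K \<zeta>)\<close> on the left
  half-plane, with \<open>K \<zeta> = \<zeta> + log (G z / z)\<close> and \<open>K' = z G' / G\<close>. So \<open>K\<close> is injective by the Noshiro-Warschawski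
  criterion, and \<open>K (\<zeta> + 2 \<pi> i n) = K \<zeta> + 2 \<pi> i n\<close> transfers injectivity to \<open>G\<close>.
\<close>
lemma starlike_univalent:
  assumes G: "G holomorphic_on ball 0 1" "G 0 = 0" "deriv G 0 \<noteq> 0"
    and pos: "\<And>z. z \<in> ball 0 1 - {0} \<Longrightarrow> 0 < Re (z * deriv G z / G z)"
  shows "inj_on G (ball 0 1)"
proof -
  have nz: "G z \<noteq> 0" if "z \<in> ball 0 1 - {0}" for z using pos[OF that] by auto
  let ?u = "quot_id G"
  have u: "?u holomorphic_on ball 0 1" by (rule quot_id_holomorphic[OF G(1,2)])
  have unz: "?u z \<noteq> 0" if "z \<in> ball 0 1" for z
    using nz[of z] that G(3) by (auto simp: quot_id_def)
  obtain l where l: "l holomorphic_on ball 0 1" "\<And>z. z \<in> ball 0 1 \<Longrightarrow> ?u z = exp (l z)"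
    using contractible_imp_holomorphic_log[OF u convex_imp_contractible[OF convex_ball] unz] by blast
  define K where "K \<zeta> = \<zeta> + l (exp \<zeta>)" for \<zeta>
  define S where "S = {\<zeta>::complex. Re \<zeta> < 0}"
  have mem: "exp \<zeta> \<in> ball 0 1 - {0}" if "\<zeta> \<in> S" for \<zeta> using that by (simp add: S_def)
  have GK: "G (exp \<zeta>) = exp (K \<zeta>)" if "\<zeta> \<in> S" for \<zeta>
    using mult_quot_id[of G "exp \<zeta>"] G(2) l(2)[of "exp \<zeta>"] mem[OF that]
    by (simp add: K_def exp_add)
  have "inj_on K S"
  proof (rule Noshiro_Warschawski)
    show "convex S" "open S" by (simp_all add: S_def convex_halfspace_Re_lt open_halfspace_Re_lt)
    fix \<zeta> assume \<zeta>: "\<zeta> \<in> S"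
    let ?z = "exp \<zeta>"
    have dl: "(l has_field_derivative deriv l ?z) (at ?z)"
      using mem[OF \<zeta>] by (intro holomorphic_derivI[OF l(1)]) auto
    show "(K has_field_derivative (1 + deriv l ?z * ?z)) (at \<zeta>)"
      unfolding K_def[abs_def] by (auto intro!: derivative_eq_intros DERIV_chain2[where f = l and g = exp, OF dl])
    have "((\<lambda>z. z * exp (l z)) has_field_derivative (exp (l ?z) + ?z * (exp (l ?z) * deriv l ?z))) (at ?z)"
      by (auto intro!: derivative_eq_intros dl)
    then have "(G has_field_derivative (exp (l ?z) + ?z * (exp (l ?z) * deriv l ?z))) (at ?z)"
      by (rule has_field_derivative_transform_within_open[of _ _ _ "ball 0 1"])
         (use mem[OF \<zeta>] G(2) in \<open>auto simp flip: l(2) simp: mult_quot_id[of G]\<close>)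
    then have "deriv G ?z = exp (l ?z) + ?z * (exp (l ?z) * deriv l ?z)" by (rule DERIV_imp_deriv)
    moreover have "G ?z = ?z * exp (l ?z)" using GK[OF \<zeta>] by (simp add: K_def exp_add)
    ultimately have "?z * deriv G ?z / G ?z = 1 + deriv l ?z * ?z" by (simp add: field_simps)
    then show "0 < Re (1 + deriv l ?z * ?z)" using pos[OF mem[OF \<zeta>]] by simp
  qed
  show ?thesis
  proof (rule inj_onI)
    fix x y assume xy: "x \<in> ball 0 1" "y \<in> ball 0 1" "G x = G y"
    show "x = y"
    proof (cases "x = 0 \<or> y = 0")
      case True then show ?thesis using xy nz G(2) by (metis Diff_iff singletonD)
    next
      case False
      then have S: "Ln x \<in> S" "Ln y \<in> S" and [simp]: "x \<noteq> 0" "y \<noteq> 0"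
        using xy by (auto simp: S_def)
      have "exp (K (Ln x)) = exp (K (Ln y))" using GK[OF S(1)] GK[OF S(2)] xy(3) by simp
      then obtain n :: int where n: "K (Ln x) = K (Ln y) + of_real (real_of_int (2 * n) * pi) * \<i>"
        unfolding exp_eq by auto
      let ?y = "Ln y + of_real (real_of_int (2 * n) * pi) * \<i>"
      have e: "exp ?y = exp (Ln y)" unfolding exp_eq by blast
      \<comment> \<open>translation by \<open>2 \<pi> i n\<close> commutes with \<open>K\<close>\<close>
      have "K ?y = K (Ln y) + of_real (real_of_int (2 * n) * pi) * \<i>"
        unfolding K_def e by (simp only: add_ac)
      then have "K ?y = K (Ln x)" by (simp only: n)
      moreover have "?y \<in> S" using S(2) by (simp add: S_def)
      ultimately have "?y = Ln x" using \<open>inj_on K S\<close> S(1) by (auto dest: inj_onD)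
      then show "x = y" using e by (metis exp_Ln \<open>x \<noteq> 0\<close> \<open>y \<noteq> 0\<close>)
    qed
  qed
qed

text \<open>
  The second coefficient \<open>c\<close> of the numerator in \<open>h_fun \<sigma> \<epsilon> z = z (1 + c z) / (1 - z)\<^sup>2\<close>. The Hadamard
  product of \<open>G\<close> with this function is \<open>(1 + c) z G' - c G\<close>.
\<close>
definition conv_coeff :: "real \<Rightarrow> complex \<Rightarrow> complex" where
  "conv_coeff \<sigma> \<epsilon> = (\<epsilon> + of_real (2 * \<sigma> - 1)) / of_real (2 * (1 - \<sigma>))"

lemma conv_coeff_zero_iff:
  assumes "\<sigma> < 1"
  shows "(1 + conv_coeff \<sigma> \<epsilon>) * d - conv_coeff \<sigma> \<epsilon> * g = 0 \<longleftrightarrow>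
     (1 + \<epsilon>) * d = (\<epsilon> + of_real (2 * \<sigma> - 1)) * g"
proof -
  have nz: "complex_of_real (2 * (1 - \<sigma>)) \<noteq> 0" using assms by simp
  have "1 + conv_coeff \<sigma> \<epsilon> = (1 + \<epsilon>) / of_real (2 * (1 - \<sigma>))"
    using nz unfolding conv_coeff_def by (subst add_divide_eq_iff) (auto simp: field_simps)
  then show ?thesis using nz unfolding conv_coeff_def
    by (simp add: divide_eq_eq del: of_real_mult of_real_diff)
qed

text \<open>
  The equation says \<open>\<bar>1 - w\<bar> = \<bar>w - (2 \<sigma> - 1)\<bar>\<close>: the point \<open>w\<close> is equidistant from \<open>1\<close> and \<open>2 \<sigma> - 1\<close>.
\<close>
lemma Re_on_line:
  assumes "norm \<epsilon> = 1" "(1 + \<epsilon>) * w = \<epsilon> + of_real (2 * \<sigma> - 1)" "\<sigma> < 1"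
  shows "Re w = \<sigma>"
proof -
  have "\<epsilon> * (1 - w) = w - of_real (2 * \<sigma> - 1)" using assms(2) by (simp add: algebra_simps)
  then have "norm (1 - w) = norm (w - of_real (2 * \<sigma> - 1))" using assms(1)
    by (metis norm_mult mult_1)
  then have "(norm (1 - w))\<^sup>2 = (norm (w - of_real (2 * \<sigma> - 1)))\<^sup>2" by simp
  then have "(1 - Re w)\<^sup>2 = (Re w - (2 * \<sigma> - 1))\<^sup>2"
    unfolding cmod_power2 by simp
  then have "1 - Re w = Re w - (2 * \<sigma> - 1) \<or> 1 - Re w = - (Re w - (2 * \<sigma> - 1))"
    unfolding power2_eq_iff .
  then show ?thesis using assms(3) by auto
qed

text \<open>
  The value of \<open>z G' / G\<close> at \<open>0\<close> is \<open>1\<close>, on the right of the line \<open>Re w = \<sigma>\<close>, so by connectedness the range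
  stays there if it avoids the line. Every point \<open>w\<close> of the line solves \<open>(1 + \<epsilon>) w = \<epsilon> + 2 \<sigma> - 1\<close> for exactly
  one unimodular \<open>\<epsilon> \<noteq> -1\<close>, and \<open>\<epsilon> = -1\<close> takes care of the zeros of \<open>G\<close>.
\<close>
lemma starlike_convolution_criterion:
  assumes G: "G holomorphic_on ball 0 1" "G 0 = 0" "deriv G 0 = 1" and \<sigma>: "0 \<le> \<sigma>" "\<sigma> < 1"
  shows "(\<forall>z\<in>ball 0 1 - {0}. \<sigma> < Re (z * deriv G z / G z)) \<longleftrightarrow>
    (\<forall>z\<in>ball 0 1 - {0}. \<forall>\<epsilon>. norm \<epsilon> = 1 \<longrightarrow>
       (1 + conv_coeff \<sigma> \<epsilon>) * (z * deriv G z) - conv_coeff \<sigma> \<epsilon> * G z \<noteq> 0)" (is "?L \<longleftrightarrow> ?R")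
proof
  assume L: ?L
  show ?R
  proof (intro ballI allI impI notI)
    fix z \<epsilon> assume z: "z \<in> ball 0 1 - {0}" and \<epsilon>: "norm \<epsilon> = 1"
      and "(1 + conv_coeff \<sigma> \<epsilon>) * (z * deriv G z) - conv_coeff \<sigma> \<epsilon> * G z = 0"
    then have eq: "(1 + \<epsilon>) * (z * deriv G z) = (\<epsilon> + of_real (2 * \<sigma> - 1)) * G z"
      using conv_coeff_zero_iff[OF \<sigma>(2)] by blast
    have gt: "\<sigma> < Re (z * deriv G z / G z)" using L z by blast
    then have "G z \<noteq> 0" using \<sigma>(1) by auto
    then have "(1 + \<epsilon>) * (z * deriv G z / G z) = \<epsilon> + of_real (2 * \<sigma> - 1)"
      using eq by (simp add: field_simps)
    from Re_on_line[OF \<epsilon> this \<sigma>(2)] gt show False by simp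
  qed
next
  assume R: ?R
  have nz: "G z \<noteq> 0" if "z \<in> ball 0 1 - {0}" for z
  proof
    assume "G z = 0"
    then have "(1 + conv_coeff \<sigma> (-1)) * (z * deriv G z) - conv_coeff \<sigma> (-1) * G z = 0"
      using conv_coeff_zero_iff[OF \<sigma>(2), of "-1" "z * deriv G z" "G z"] by simp
    then show False using R that by (metis norm_minus_cancel norm_one)
  qed
  \<comment> \<open>\<open>z G' / G\<close> with its removable singularity at \<open>0\<close> filled in\<close>
  define s where "s z = deriv G z / quot_id G z" for z
  have s: "s z = z * deriv G z / G z" if "z \<noteq> 0" for z
    using that by (simp add: s_def quot_id_def)
  have unz: "quot_id G z \<noteq> 0" if "z \<in> ball 0 1" for z
    using nz[of z] that G(3) by (auto simp: quot_id_def)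
  have "continuous_on (ball 0 1) s"
    unfolding s_def[abs_def] using unz quot_id_holomorphic[OF G(1,2)]
    by (intro holomorphic_on_imp_continuous_on holomorphic_intros G(1)) auto
  then have "connected ((\<lambda>z. Re (s z)) ` ball 0 1)"
    by (intro connected_continuous_image continuous_intros) auto
  then have int: "is_interval ((\<lambda>z. Re (s z)) ` ball 0 1)" by (simp add: is_interval_connected_1)
  have s0: "s 0 = 1" by (simp add: s_def quot_id_def G)
  show ?L
  proof (rule ballI, rule ccontr)
    fix z assume z: "z \<in> ball 0 1 - {0}" and "\<not> \<sigma> < Re (z * deriv G z / G z)"
    then have le: "Re (s z) \<le> \<sigma>" by (simp add: s)
    have "\<sigma> \<in> (\<lambda>z. Re (s z)) ` ball 0 1"
    proof (rule mem_is_interval_1_I[OF int])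
      show "Re (s z) \<in> (\<lambda>z. Re (s z)) ` ball 0 1" using z by blast
      show "Re (s 0) \<in> (\<lambda>z. Re (s z)) ` ball 0 1" by (rule imageI) simp
    qed (use le s0 \<sigma> in auto)
    then obtain y where y: "y \<in> ball 0 1" "Re (s y) = \<sigma>" by auto
    then have y0: "y \<noteq> 0" using s0 \<sigma> by auto
    \<comment> \<open>the parameter that belongs to the point \<open>s y\<close> of the line\<close>
    define \<epsilon> where "\<epsilon> = (s y - of_real (2 * \<sigma> - 1)) / (1 - s y)"
    have ne: "1 - s y \<noteq> 0" using y(2) \<sigma>(2) by (auto simp: complex_eq_iff)
    have "(norm (s y - of_real (2 * \<sigma> - 1)))\<^sup>2 = (norm (1 - s y))\<^sup>2"
      unfolding cmod_power2 using y(2) by (simp add: power2_eq_square algebra_simps)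
    then have "norm (s y - of_real (2 * \<sigma> - 1)) = norm (1 - s y)" by simp
    then have "norm \<epsilon> = 1" using ne by (simp add: \<epsilon>_def norm_divide)
    moreover have "(1 + \<epsilon>) * s y = \<epsilon> + of_real (2 * \<sigma> - 1)"
      using ne by (simp add: \<epsilon>_def field_simps)
    then have "(1 + \<epsilon>) * (y * deriv G y) = (\<epsilon> + of_real (2 * \<sigma> - 1)) * G y"
      using nz[of y] y y0 by (simp add: s field_simps)
    ultimately show False using R y(1) y0 conv_coeff_zero_iff[OF \<sigma>(2)] by blast
  qed
qed

section \<open>Averages and tail integrals on the unit interval\<close>

text \<open>
  A class of integrands that contains the kernels below and is preserved by \<open>averaging\<close>.
\<close>
definition bdd_borel :: "(real \<Rightarrow> real) \<Rightarrow> bool" where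
  "bdd_borel \<phi> \<longleftrightarrow> \<phi> \<in> borel_measurable borel \<and> (\<exists>B. \<forall>t\<in>{0..1}. \<bar>\<phi> t\<bar> \<le> B)"

lemma lebesgue_eq_lborel_integral:
  fixes f :: "real \<Rightarrow> 'b::{banach, second_countable_topology}"
  assumes "S \<in> sets borel" "f \<in> borel_measurable borel"
  shows "(LINT x:S|lebesgue. f x) = (LINT x:S|lborel. f x)"
    "set_integrable lebesgue S f \<longleftrightarrow> set_integrable lborel S f"
proof -
  have "(\<lambda>x. indicator S x *\<^sub>R f x) \<in> borel_measurable lborel"
    using assms by simp
  then show "(LINT x:S|lebesgue. f x) = (LINT x:S|lborel. f x)"
    "set_integrable lebesgue S f \<longleftrightarrow> set_integrable lborel S f"
    unfolding set_lebesgue_integral_def set_integrable_def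
    by (rule integral_completion, rule integrable_completion)
qed

lemma set_lebesgue_integral_cong_off_0:
  fixes f g :: "real \<Rightarrow> 'b::{banach, second_countable_topology}"
  assumes "\<And>x. x \<in> S \<Longrightarrow> x \<noteq> 0 \<Longrightarrow> f x = g x"
  shows "(LINT x:S|lebesgue. f x) = (LINT x:S|lebesgue. g x)"
  unfolding set_lebesgue_integral_def
  by (rule integral_discrete_difference[of "{0}"]) (use assms in \<open>auto split: split_indicator\<close>)

lemma powr_moment:
  fixes a x :: real
  assumes a: "0 < a" and x: "0 \<le> x"
  shows "set_integrable lborel {0..x} (\<lambda>t. t powr (a - 1))"
    and "(LINT t:{0..x}|lborel. t powr (a - 1)) = x powr a / a"
proof -
  have hi: "((\<lambda>t. t powr (a - 1)) has_integral x powr a / a) {0..x}"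
    using has_integral_powr_from_0[of "a - 1" x] a x by simp
  then have "(\<lambda>t. t powr (a - 1)) absolutely_integrable_on {0..x}"
    by (intro nonnegative_absolutely_integrable_1) (auto dest: has_integral_integrable)
  then show I: "set_integrable lborel {0..x} (\<lambda>t. t powr (a - 1))"
    by (subst lebesgue_eq_lborel_integral(2)[symmetric]) auto
  show "(LINT t:{0..x}|lborel. t powr (a - 1)) = x powr a / a"
    using set_borel_integral_eq_integral(2)[OF I] hi by (simp add: integral_unique)
qed

text \<open>
  Up to the factor \<open>a\<close>, the mean of \<open>\<phi> (s x)\<close> under the probability density \<open>a s\<^sup>a\<^sup>-\<^sup>1\<close> on \<open>[0, 1]\<close>. On
  monomials it acts as \<open>1 / (a + \<theta>)\<close> with \<open>\<theta> = x d/dx\<close>.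
\<close>
definition averaging :: "real \<Rightarrow> (real \<Rightarrow> real) \<Rightarrow> real \<Rightarrow> real" where
  "averaging a \<phi> x = (LINT s:{0..1}|lborel. \<phi> (s * x) * s powr (a - 1))"

lemma averaging_integrable:
  assumes a: "0 < a" and \<phi>: "bdd_borel \<phi>" and x: "0 \<le> x" "x \<le> 1"
  shows "set_integrable lborel {0..1} (\<lambda>s. \<phi> (s * x) * s powr (a - 1))"
    and "set_integrable lborel {0..x} (\<lambda>t. \<phi> t * t powr (a - 1))"
proof -
  obtain B where B: "\<And>t. t \<in> {0..1} \<Longrightarrow> \<bar>\<phi> t\<bar> \<le> B" and [measurable]: "\<phi> \<in> borel_measurable borel"
    using \<phi> unfolding bdd_borel_def by blast
  have *: "set_integrable lborel {0..y} (\<lambda>s. f s * s powr (a - 1))"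
    if "0 \<le> y" "f \<in> borel_measurable borel" "\<And>s. s \<in> {0..y} \<Longrightarrow> \<bar>f s\<bar> \<le> B" for f y
  proof -
    have [measurable]: "f \<in> borel_measurable borel" by fact
    have "set_integrable lborel {0..y} (\<lambda>s. B * s powr (a - 1))"
      using powr_moment(1)[OF a that(1)] by simp
    then show ?thesis unfolding set_integrable_def
      by (rule Bochner_Integration.integrable_bound)
         (use that(3) in \<open>auto intro!: AE_I2 mult_right_mono order_trans[OF that(3) abs_ge_self]
             simp: abs_mult split: split_indicator\<close>)
  qed
  show "set_integrable lborel {0..1} (\<lambda>s. \<phi> (s * x) * s powr (a - 1))"
    by (rule *) (use x in \<open>auto intro!: B mult_le_one\<close>)
  show "set_integrable lborel {0..x} (\<lambda>t. \<phi> t * t powr (a - 1))"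
    by (rule *) (use x in \<open>auto intro!: B\<close>)
qed

lemma averaging_scale:
  assumes x: "0 < x" and a: "0 < a"
  shows "(LINT t:{0..x}|lborel. \<phi> t * t powr (a - 1)) = x powr a * averaging a \<phi> x"
proof -
  have "(LINT t:{0..x}|lborel. \<phi> t * t powr (a - 1)) =
      x * (\<integral>s. indicator {0..x} (x * s) *\<^sub>R (\<phi> (x * s) * (x * s) powr (a - 1)) \<partial>lborel)"
    unfolding set_lebesgue_integral_def using x
    by (subst lborel_integral_real_affine[of x _ 0]) auto
  also have "(\<lambda>s. indicator {0..x} (x * s) *\<^sub>R (\<phi> (x * s) * (x * s) powr (a - 1))) =
      (\<lambda>s. x powr (a - 1) * (indicator {0..1} s *\<^sub>R (\<phi> (s * x) * s powr (a - 1))))"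
    using x by (auto simp: fun_eq_iff powr_mult mult_ac zero_le_mult_iff split: split_indicator)
  also have "x * (\<integral>s. x powr (a - 1) * (indicator {0..1} s *\<^sub>R (\<phi> (s * x) * s powr (a - 1))) \<partial>lborel)
     = (x * x powr (a - 1)) * averaging a \<phi> x"
    unfolding averaging_def set_lebesgue_integral_def by (subst integral_mult_right_zero) simp
  also have "x * x powr (a - 1) = x powr a" using x by (simp add: powr_mult_base)
  finally show ?thesis .
qed

lemma bdd_borel_averaging:
  assumes a: "0 < a" and \<phi>: "bdd_borel \<phi>"
  shows "bdd_borel (averaging a \<phi>)"
proof -
  obtain B where B: "\<And>t. t \<in> {0..1} \<Longrightarrow> \<bar>\<phi> t\<bar> \<le> B" and [measurable]: "\<phi> \<in> borel_measurable borel"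
    using \<phi> unfolding bdd_borel_def by blast
  have "averaging a \<phi> \<in> borel_measurable borel"
    unfolding averaging_def[abs_def] set_lebesgue_integral_def by measurable
  moreover have "\<bar>averaging a \<phi> x\<bar> \<le> B * (1 / a)" if x: "x \<in> {0..1}" for x
  proof -
    have i: "set_integrable lborel {0..1} (\<lambda>s. \<phi> (s * x) * s powr (a - 1))"
      by (rule averaging_integrable(1)[OF a \<phi>]) (use x in auto)
    have m: "set_integrable lborel {0..1} (\<lambda>s. B * s powr (a - 1))"
      using powr_moment(1)[OF a, of 1] by simp
    have le: "\<bar>\<phi> (s * x)\<bar> \<le> B" if "s \<in> {0..1}" for s
      using x that by (intro B) (auto intro!: mult_le_one)
    have "\<bar>averaging a \<phi> x\<bar> \<le> (LINT s:{0..1}|lborel. \<bar>\<phi> (s * x) * s powr (a - 1)\<bar>)"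
      unfolding averaging_def using set_integral_norm_bound[OF i] by simp
    also have "\<dots> \<le> (LINT s:{0..1}|lborel. B * s powr (a - 1))"
      by (intro set_integral_mono set_integrable_abs i m) (auto simp: abs_mult intro!: mult_right_mono le)
    also have "\<dots> = B * (1 / a)" using powr_moment(2)[OF a, of 1] by simp
    finally show ?thesis .
  qed
  ultimately show ?thesis unfolding bdd_borel_def by blast
qed

lemma averaging_power:
  assumes a: "0 < a"
  shows "averaging a (\<lambda>t. t ^ k) x = x ^ k / (a + k)"
proof -
  have "averaging a (\<lambda>t. t ^ k) x = (LINT s:{0..1}|lborel. x ^ k * s powr ((a + k) - 1))"
    unfolding averaging_def
  proof (rule set_lebesgue_integral_cong, simp, intro allI impI)
    fix s :: real assume "s \<in> {0..1}"
    then have "s ^ k * s powr (a - 1) = s powr ((a + k) - 1)"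
      by (cases "s = 0")
         (simp_all add: power_0_left powr_realpow[symmetric] powr_add[symmetric] algebra_simps)
    then show "(s * x) ^ k * s powr (a - 1) = x ^ k * s powr ((a + k) - 1)"
      by (simp add: power_mult_distrib mult_ac)
  qed
  also have "\<dots> = x ^ k / (a + k)"
    using powr_moment(2)[of "a + k" 1] a by simp
  finally show ?thesis .
qed

lemma sigma_finite_lebesgue: "sigma_finite_measure (lebesgue :: real measure)"
proof
  obtain A :: "real set set" where A: "countable A" "A \<subseteq> sets lborel" "\<Union>A = space lborel" "\<forall>a\<in>A. emeasure lborel a \<noteq> \<infinity>"
    using lborel.sigma_finite_countable by auto
  then show "\<exists>A::real set set. countable A \<and> A \<subseteq> sets lebesgue \<and> \<Union>A = space lebesgue \<and> (\<forall>a\<in>A. emeasure lebesgue a \<noteq> \<infinity>)"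
    by (intro exI[of _ A]) (auto simp: subset_eq)
qed

text \<open>
  Fubini's theorem on the triangle \<open>0 \<le> t \<le> x \<le> 1\<close>. The mass of \<open>t\<^sup>a\<^sup>-\<^sup>1 dt\<close> below \<open>x\<close> is
  \<open>x\<^sup>a / a\<close>, so integrability of \<open>\<psi>(x) x\<^sup>a\<close> dominates the double integral.
\<close>
lemma tail_weight_integral:
  fixes \<psi> \<phi> :: "real \<Rightarrow> real"
  assumes a: "0 < a" and \<psi>: "set_borel_measurable lebesgue {0..1} \<psi>"
    and nonneg: "\<And>x. x \<in> {0..1} \<Longrightarrow> 0 \<le> \<psi> x"
    and int: "set_integrable lebesgue {0..1} (\<lambda>x. \<psi> x * x powr a)"
    and \<phi>: "bdd_borel \<phi>"
  shows "set_integrable lebesgue {0..1} (\<lambda>t. t powr (a - 1) * (LINT x:{t..1}|lebesgue. \<psi> x) * \<phi> t)"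
    and "(LINT t:{0..1}|lebesgue. t powr (a - 1) * (LINT x:{t..1}|lebesgue. \<psi> x) * \<phi> t)
        = (LINT x:{0..1}|lebesgue. \<psi> x * x powr a * averaging a \<phi> x)"
proof -
  interpret L: sigma_finite_measure "lebesgue :: real measure" by (rule sigma_finite_lebesgue)
  interpret LL: pair_sigma_finite "lebesgue :: real measure" "lebesgue :: real measure" ..
  obtain B where B: "\<And>t. t \<in> {0..1} \<Longrightarrow> \<bar>\<phi> t\<bar> \<le> B" and \<phi>m: "\<phi> \<in> borel_measurable borel"
    using \<phi> unfolding bdd_borel_def by blast
  have [measurable]: "\<phi> \<in> borel_measurable lebesgue" using \<phi>m by (simp add: measurable_completion)
  have id [measurable]: "(\<lambda>x. x) \<in> borel_measurable (lebesgue :: real measure)"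
    by (simp add: measurable_completion)
  have [measurable]: "fst \<in> borel_measurable (lebesgue \<Otimes>\<^sub>M lebesgue :: (real \<times> real) measure)"
      "snd \<in> borel_measurable (lebesgue \<Otimes>\<^sub>M lebesgue :: (real \<times> real) measure)"
    using measurable_compose[OF measurable_fst id] measurable_compose[OF measurable_snd id] by auto
  have [measurable]: "(\<lambda>x. indicator {0..1} x *\<^sub>R \<psi> x) \<in> borel_measurable lebesgue"
    using \<psi> by (simp add: set_borel_measurable_def)
  have pw: "(\<lambda>t::real. t powr (a - 1)) \<in> borel_measurable lebesgue" by measurable
  define F where "F x t = (if 0 \<le> t \<and> t \<le> x \<and> x \<le> 1 then t powr (a - 1) * \<phi> t * (indicator {0..1} x *\<^sub>R \<psi> x) else 0)" for x t :: real
  have Fm: "case_prod F \<in> borel_measurable (lebesgue \<Otimes>\<^sub>M lebesgue)"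
    unfolding F_def[abs_def] case_prod_beta' by measurable
  have bl: "(LINT t:{0..x}|lebesgue. f t * t powr (a - 1)) = x powr a * averaging a f x"
    "set_integrable lebesgue {0..x} (\<lambda>t. f t * t powr (a - 1))"
    if f: "bdd_borel f" and x: "0 \<le> x" "x \<le> 1" for f x
  proof -
    have [measurable]: "f \<in> borel_measurable borel" using f by (simp add: bdd_borel_def)
    have eq: "(LINT t:{0..x}|lebesgue. f t * t powr (a - 1)) = (LINT t:{0..x}|lborel. f t * t powr (a - 1))"
      by (rule lebesgue_eq_lborel_integral(1)) auto
    show "(LINT t:{0..x}|lebesgue. f t * t powr (a - 1)) = x powr a * averaging a f x"
    proof (cases "x = 0")
      case True
      have "(\<lambda>t. indicator {0..0} t *\<^sub>R (f t * t powr (a - 1))) = (\<lambda>t. 0)"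
        by (auto split: split_indicator)
      then show ?thesis unfolding set_lebesgue_integral_def True using a by (simp only:) simp
    next
      case False then show ?thesis using averaging_scale[of x a f] x a by (simp add: eq)
    qed
    show "set_integrable lebesgue {0..x} (\<lambda>t. f t * t powr (a - 1))"
      using averaging_integrable(2)[OF a f x] by (subst lebesgue_eq_lborel_integral(2)) auto
  qed
  have Feq: "F x t = (if x \<in> {0..1} then \<psi> x * (indicator {0..x} t *\<^sub>R (\<phi> t * t powr (a - 1))) else 0)" for x t
    by (auto simp: F_def split: split_indicator)
  have Fx: "integrable lebesgue (F x)" for x
  proof (cases "x \<in> {0..1}")
    case True
    then show ?thesis
      using bl(2)[OF \<phi>, of x] unfolding set_integrable_def by (simp add: Feq[abs_def])
  next
    case False then show ?thesis unfolding Feq[abs_def] by (simp only: if_False) simp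
  qed
  have inner: "(\<integral>t. F x t \<partial>lebesgue) = indicator {0..1} x *\<^sub>R (\<psi> x * x powr a * averaging a \<phi> x)" for x
  proof (cases "x \<in> {0..1}")
    case True
    then show ?thesis
      using bl(1)[OF \<phi>, of x] unfolding set_lebesgue_integral_def by (simp add: Feq[abs_def])
  next
    case False then show ?thesis unfolding Feq[abs_def] by (simp only: if_False) simp
  qed
  have inner_abs: "(\<integral>t. norm (F x t) \<partial>lebesgue) \<le> \<bar>B\<bar> / a * (indicator {0..1} x *\<^sub>R (\<psi> x * x powr a))" for x
  proof (cases "x \<in> {0..1}")
    case True
    have c: "bdd_borel (\<lambda>_. \<bar>B\<bar>)" by (auto simp: bdd_borel_def)
    have "(\<integral>t. norm (F x t) \<partial>lebesgue) \<le> (\<integral>t. \<psi> x * (indicator {0..x} t *\<^sub>R (\<bar>B\<bar> * t powr (a - 1))) \<partial>lebesgue)"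
    proof (rule integral_mono)
      show "integrable lebesgue (\<lambda>t. norm (F x t))" using Fx by (rule integrable_norm)
      show "integrable lebesgue (\<lambda>t. \<psi> x * (indicator {0..x} t *\<^sub>R (\<bar>B\<bar> * t powr (a - 1))))"
        using bl(2)[OF c, of x] True unfolding set_integrable_def by simp
      show "norm (F x t) \<le> \<psi> x * (indicator {0..x} t *\<^sub>R (\<bar>B\<bar> * t powr (a - 1)))" for t
        using True nonneg[OF True] B[of t]
        by (auto simp: Feq abs_mult split: split_indicator intro!: mult_left_mono mult_right_mono)
    qed
    also have "\<dots> = \<psi> x * (x powr a * averaging a (\<lambda>_. \<bar>B\<bar>) x)"
      using bl(1)[OF c, of x] True unfolding set_lebesgue_integral_def by simp
    also have "averaging a (\<lambda>_. \<bar>B\<bar>) x = \<bar>B\<bar> / a"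
      using powr_moment(2)[OF a, of 1] by (simp add: averaging_def)
    finally show ?thesis using True by (simp add: mult_ac)
  next
    case False then show ?thesis unfolding Feq[abs_def] by (simp only: if_False) simp
  qed
  have FI: "integrable (lebesgue \<Otimes>\<^sub>M lebesgue) (case_prod F)"
  proof (rule LL.Fubini_integrable[OF Fm])
    have m: "(\<lambda>x. \<integral>t. norm (F x t) \<partial>lebesgue) \<in> borel_measurable lebesgue"
      using Fm by measurable
    have "integrable lebesgue (\<lambda>x. \<bar>B\<bar> / a * (indicator {0..1} x *\<^sub>R (\<psi> x * x powr a)))"
      using int unfolding set_integrable_def by (rule integrable_mult_right)
    then have "integrable lebesgue (\<lambda>x. \<integral>t. norm (F x t) \<partial>lebesgue)"
    proof (rule Bochner_Integration.integrable_bound[OF _ m])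
      show "AE x in lebesgue. norm (\<integral>t. norm (F x t) \<partial>lebesgue)
          \<le> norm (\<bar>B\<bar> / a * (indicator {0..1} x *\<^sub>R (\<psi> x * x powr a)))"
      proof (rule AE_I2)
        fix x :: real
        have "norm (\<integral>t. norm (F x t) \<partial>lebesgue) = (\<integral>t. norm (F x t) \<partial>lebesgue)"
          by simp
        also note inner_abs
        finally show "norm (\<integral>t. norm (F x t) \<partial>lebesgue)
          \<le> norm (\<bar>B\<bar> / a * (indicator {0..1} x *\<^sub>R (\<psi> x * x powr a)))"
          unfolding real_norm_def by (rule order_trans[OF _ abs_ge_self])
      qed
    qed
    then show "integrable lebesgue (\<lambda>x. \<integral>t. norm (case_prod F (x, t)) \<partial>lebesgue)"
      by simp
    show "AE x in lebesgue. integrable lebesgue (\<lambda>t. case_prod F (x, t))" using Fx by simp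
  qed
  have outer: "(\<integral>x. F x t \<partial>lebesgue) =
      indicator {0..1} t *\<^sub>R (t powr (a - 1) * (LINT x:{t..1}|lebesgue. \<psi> x) * \<phi> t)" for t
  proof (cases "t \<in> {0..1}")
    case True
    have "F x t = t powr (a - 1) * \<phi> t * (indicator {t..1} x *\<^sub>R \<psi> x)" for x
      using True by (auto simp: F_def split: split_indicator)
    then have "(\<integral>x. F x t \<partial>lebesgue) = t powr (a - 1) * \<phi> t * (\<integral>x. indicator {t..1} x *\<^sub>R \<psi> x \<partial>lebesgue)"
      by (simp only: integral_mult_right_zero)
    then show ?thesis using True by (simp add: set_lebesgue_integral_def)
  next
    case False
    then have "F x t = 0" for x by (auto simp: F_def)
    then show ?thesis using False by simp
  qed
  show "set_integrable lebesgue {0..1} (\<lambda>t. t powr (a - 1) * (LINT x:{t..1}|lebesgue. \<psi> x) * \<phi> t)"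
    using LL.integrable_snd[OF FI] unfolding outer set_integrable_def .
  show "(LINT t:{0..1}|lebesgue. t powr (a - 1) * (LINT x:{t..1}|lebesgue. \<psi> x) * \<phi> t)
        = (LINT x:{0..1}|lebesgue. \<psi> x * x powr a * averaging a \<phi> x)"
    using LL.Fubini_integral[OF FI] unfolding outer inner set_lebesgue_integral_def .
qed

lemma Lam_fun_weight:
  assumes \<nu>: "0 < \<nu>" and nonneg: "\<And>t. t \<in> {0..1} \<Longrightarrow> 0 \<le> lam t"
    and lam: "set_integrable lebesgue {0..1} lam" and \<phi>: "bdd_borel \<phi>"
  shows "set_integrable lebesgue {0..1} (\<lambda>t. t powr (1 / \<nu> - 1) * Lam_fun lam \<nu> t * \<phi> t)"
    and "(LINT t:{0..1}|lebesgue. t powr (1 / \<nu> - 1) * Lam_fun lam \<nu> t * \<phi> t)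
       = (LINT x:{0..1}|lebesgue. lam x * averaging (1 / \<nu>) \<phi> x)"
proof -
  let ?\<psi> = "\<lambda>x. lam x / x powr (1 / \<nu>)"
  have id [measurable]: "(\<lambda>x. x) \<in> borel_measurable (lebesgue :: real measure)"
    by (simp add: measurable_completion)
  have lm [measurable]: "(\<lambda>x. indicator {0..1} x *\<^sub>R lam x) \<in> borel_measurable lebesgue"
    using lam by (auto simp: set_integrable_def)
  have m: "set_borel_measurable lebesgue {0..1} ?\<psi>"
  proof -
    have "(\<lambda>x. (indicator {0..1} x *\<^sub>R lam x) / x powr (1 / \<nu>)) \<in> borel_measurable lebesgue"
      by measurable
    then show ?thesis by (simp add: set_borel_measurable_def)
  qed
  have cancel: "?\<psi> x * x powr (1 / \<nu>) = lam x" if "x \<noteq> 0" for x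
    using that by simp
  have i: "set_integrable lebesgue {0..1} (\<lambda>x. ?\<psi> x * x powr (1 / \<nu>))"
    unfolding set_integrable_def
  proof (rule Bochner_Integration.integrable_bound[OF lam[unfolded set_integrable_def]])
    have "(\<lambda>x. (indicator {0..1} x *\<^sub>R lam x) / x powr (1 / \<nu>) * x powr (1 / \<nu>)) \<in> borel_measurable lebesgue"
      by measurable
    then show "(\<lambda>x. indicator {0..1} x *\<^sub>R (?\<psi> x * x powr (1 / \<nu>))) \<in> borel_measurable lebesgue"
      by (simp only: real_scaleR_def times_divide_eq_right times_divide_eq_left mult.assoc)
  qed (auto simp: indicator_def)
  have n: "0 \<le> ?\<psi> x" if "x \<in> {0..1}" for x using nonneg[OF that] by simp
  note T = tail_weight_integral[OF _ m n i \<phi>, folded Lam_fun_def]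
  show "set_integrable lebesgue {0..1} (\<lambda>t. t powr (1 / \<nu> - 1) * Lam_fun lam \<nu> t * \<phi> t)"
    using T(1) \<nu> by simp
  have "(LINT t:{0..1}|lebesgue. t powr (1 / \<nu> - 1) * Lam_fun lam \<nu> t * \<phi> t)
     = (LINT x:{0..1}|lebesgue. ?\<psi> x * x powr (1 / \<nu>) * averaging (1 / \<nu>) \<phi> x)"
    by (rule T(2)) (use \<nu> in auto)
  also have "\<dots> = (LINT x:{0..1}|lebesgue. lam x * averaging (1 / \<nu>) \<phi> x)"
    by (rule set_lebesgue_integral_cong_off_0) simp
  finally show "(LINT t:{0..1}|lebesgue. t powr (1 / \<nu> - 1) * Lam_fun lam \<nu> t * \<phi> t)
       = (LINT x:{0..1}|lebesgue. lam x * averaging (1 / \<nu>) \<phi> x)" .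
qed

lemma Lam_fun_nonneg:
  assumes "\<And>t. t \<in> {0..1} \<Longrightarrow> 0 \<le> lam t" "t \<in> {0..1}"
  shows "0 \<le> Lam_fun lam \<nu> t"
  unfolding Lam_fun_def set_lebesgue_integral_def
  by (rule Bochner_Integration.integral_nonneg) (use assms in \<open>auto split: split_indicator\<close>)

lemma Pi_fun_nonneg:
  assumes "\<And>t. t \<in> {0..1} \<Longrightarrow> 0 \<le> lam t" "t \<in> {0..1}"
  shows "0 \<le> Pi_fun lam \<mu> \<nu> t"
proof -
  have "0 \<le> Lam_fun lam \<nu> x" if "x \<in> {t..1}" for x
    using assms that by (intro Lam_fun_nonneg) auto
  then have "0 \<le> (LINT x:{t..1}|lebesgue. Lam_fun lam \<nu> x * x powr (1 / \<nu> - 1 - 1 / \<mu>))"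
    unfolding set_lebesgue_integral_def
    by (intro Bochner_Integration.integral_nonneg) (auto split: split_indicator)
  then show ?thesis using Lam_fun_nonneg[of lam t] assms unfolding Pi_fun_def by auto
qed

text \<open>
  \<open>Pi_fun\<close> is a tail integral of \<open>Lam_fun\<close>, which is itself a tail integral of \<open>lam\<close>, so the triangle formula
  is applied twice. The result is the double integral over \<open>s\<close> and \<open>w\<close> that occurs in \<open>g_fun\<close> and \<open>q_fun\<close>.
\<close>
lemma Pi_fun_weight:
  assumes \<mu>: "0 < \<mu>" and \<nu>: "0 < \<nu>" and nonneg: "\<And>t. t \<in> {0..1} \<Longrightarrow> 0 \<le> lam t"
    and lam: "set_integrable lebesgue {0..1} lam" and \<phi>: "bdd_borel \<phi>"
  shows "set_integrable lebesgue {0..1} (\<lambda>t. t powr (1 / \<mu> - 1) * Pi_fun lam \<mu> \<nu> t * \<phi> t)"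
    and "(LINT t:{0..1}|lebesgue. t powr (1 / \<mu> - 1) * Pi_fun lam \<mu> \<nu> t * \<phi> t)
       = (LINT x:{0..1}|lebesgue. lam x * averaging (1 / \<nu>) (averaging (1 / \<mu>) \<phi>) x)"
proof -
  let ?\<psi> = "\<lambda>x. Lam_fun lam \<nu> x * x powr (1 / \<nu> - 1 - 1 / \<mu>)"
  have id [measurable]: "(\<lambda>x. x) \<in> borel_measurable (lebesgue :: real measure)"
    by (simp add: measurable_completion)
  have "bdd_borel (\<lambda>_. 1)" by (auto simp: bdd_borel_def)
  from Lam_fun_weight(1)[OF \<nu> nonneg lam this]
  have i1: "set_integrable lebesgue {0..1} (\<lambda>t. t powr (1 / \<nu> - 1) * Lam_fun lam \<nu> t)" by simp
  then have [measurable]: "(\<lambda>t. indicator {0..1} t *\<^sub>R (t powr (1 / \<nu> - 1) * Lam_fun lam \<nu> t)) \<in> borel_measurable lebesgue"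
    by (auto simp: set_integrable_def)
  have split: "x powr (1 / \<nu> - 1 - 1 / \<mu>) = x powr (1 / \<nu> - 1) * x powr (- (1 / \<mu>))" for x :: real
    by (subst powr_add[symmetric]) simp
  have m: "set_borel_measurable lebesgue {0..1} ?\<psi>"
  proof -
    have "(\<lambda>t. (indicator {0..1} t *\<^sub>R (t powr (1 / \<nu> - 1) * Lam_fun lam \<nu> t)) * t powr (- (1 / \<mu>))) \<in> borel_measurable lebesgue"
      by measurable
    then show ?thesis by (simp add: set_borel_measurable_def split mult_ac)
  qed
  have cancel: "?\<psi> x * x powr (1 / \<mu>) = x powr (1 / \<nu> - 1) * Lam_fun lam \<nu> x" for x
    by (simp add: mult.assoc powr_add[symmetric])
  have i: "set_integrable lebesgue {0..1} (\<lambda>x. ?\<psi> x * x powr (1 / \<mu>))"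
    unfolding cancel by (rule i1)
  have n: "0 \<le> ?\<psi> x" if "x \<in> {0..1}" for x
    using Lam_fun_nonneg[of lam x] nonneg that by simp
  have Pi: "(LINT x:{t..1}|lebesgue. ?\<psi> x) = Pi_fun lam \<mu> \<nu> t" for t
    using \<mu> by (simp add: Pi_fun_def)
  have \<mu>': "0 < 1 / \<mu>" using \<mu> by simp
  note T = tail_weight_integral[OF \<mu>' m n i \<phi>, unfolded Pi cancel]
  show "set_integrable lebesgue {0..1} (\<lambda>t. t powr (1 / \<mu> - 1) * Pi_fun lam \<mu> \<nu> t * \<phi> t)"
    by (rule T(1))
  have "(LINT t:{0..1}|lebesgue. t powr (1 / \<mu> - 1) * Pi_fun lam \<mu> \<nu> t * \<phi> t)
      = (LINT x:{0..1}|lebesgue. x powr (1 / \<nu> - 1) * Lam_fun lam \<nu> x * averaging (1 / \<mu>) \<phi> x)"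
    by (rule T(2))
  also have "\<dots> = (LINT x:{0..1}|lebesgue. lam x * averaging (1 / \<nu>) (averaging (1 / \<mu>) \<phi>) x)"
    by (rule Lam_fun_weight(2)[OF \<nu> _ lam bdd_borel_averaging[OF \<mu>' \<phi>]]) (rule nonneg)
  finally show "(LINT t:{0..1}|lebesgue. t powr (1 / \<mu> - 1) * Pi_fun lam \<mu> \<nu> t * \<phi> t)
      = (LINT x:{0..1}|lebesgue. lam x * averaging (1 / \<nu>) (averaging (1 / \<mu>) \<phi>) x)" .
qed

lemma averaging_linear:
  assumes a: "0 < a" and \<phi>: "bdd_borel \<phi>" and \<psi>: "bdd_borel \<psi>" and x: "0 \<le> x" "x \<le> 1"
  shows "averaging a (\<lambda>t. c * \<phi> t + d * \<psi> t) x = c * averaging a \<phi> x + d * averaging a \<psi> x"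
proof -
  note I = averaging_integrable(1)[OF a \<phi> x] averaging_integrable(1)[OF a \<psi> x]
  have "averaging a (\<lambda>t. c * \<phi> t + d * \<psi> t) x =
     (LINT s:{0..1}|lborel. c * (\<phi> (s * x) * s powr (a - 1)) + d * (\<psi> (s * x) * s powr (a - 1)))"
    by (simp add: averaging_def algebra_simps)
  also have "\<dots> = c * averaging a \<phi> x + d * averaging a \<psi> x"
    unfolding averaging_def using I by (subst set_integral_add(2)) auto
  finally show ?thesis .
qed

lemma averaging_cong:
  assumes "\<And>t. t \<in> {0..1} \<Longrightarrow> \<phi> t = \<psi> t" "0 \<le> x" "x \<le> 1"
  shows "averaging a \<phi> x = averaging a \<psi> x"
  unfolding averaging_def
proof (rule set_lebesgue_integral_cong, simp, intro allI impI)
  fix s :: real assume "s \<in> {0..1}"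
  then have "s * x \<in> {0..1}" using assms(2,3) by (auto intro: mult_le_one)
  then show "\<phi> (s * x) * s powr (a - 1) = \<psi> (s * x) * s powr (a - 1)" using assms(1) by simp
qed

lemma bdd_borelI:
  assumes "\<phi> \<in> borel_measurable borel" "continuous_on {0..1} \<phi>"
  shows "bdd_borel \<phi>"
proof -
  have "bounded (\<phi> ` {0..1})"
    by (intro compact_imp_bounded compact_continuous_image assms compact_Icc)
  then obtain B where "\<forall>t\<in>{0..1}. \<bar>\<phi> t\<bar> \<le> B" unfolding bounded_iff by auto
  then show ?thesis using assms unfolding bdd_borel_def by blast
qed

lemma bdd_borel_linear:
  assumes "bdd_borel \<phi>" "bdd_borel \<psi>"
  shows "bdd_borel (\<lambda>t. c * \<phi> t + d * \<psi> t)"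
proof -
  obtain A B where A: "\<And>t. t \<in> {0..1} \<Longrightarrow> \<bar>\<phi> t\<bar> \<le> A" and B: "\<And>t. t \<in> {0..1} \<Longrightarrow> \<bar>\<psi> t\<bar> \<le> B"
    and [measurable]: "\<phi> \<in> borel_measurable borel" "\<psi> \<in> borel_measurable borel"
    using assms unfolding bdd_borel_def by blast
  have "\<bar>c * \<phi> t + d * \<psi> t\<bar> \<le> \<bar>c\<bar> * A + \<bar>d\<bar> * B" if "t \<in> {0..1}" for t
    using abs_triangle_ineq[of "c * \<phi> t" "d * \<psi> t"] mult_left_mono[OF A[OF that] abs_ge_zero[of c]]
      mult_left_mono[OF B[OF that] abs_ge_zero[of d]] by (simp add: abs_mult)
  then show ?thesis unfolding bdd_borel_def by (intro conjI exI ballI) auto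
qed

section \<open>The kernel and the density\<close>

text \<open>
  This is \<open>(1 - \<xi>) h(w) / w + \<xi> h'(w)\<close> for \<open>h(w) = w (1 + c w) / (1 - w)\<^sup>2\<close>, the analytic part of \<open>L_fun\<close>.
\<close>
definition pascu_kernel :: "real \<Rightarrow> complex \<Rightarrow> complex \<Rightarrow> complex" where
  "pascu_kernel \<xi> c w = of_real (1 - \<xi>) * ((1 + c * w) / (1 - w)\<^sup>2)
     + of_real \<xi> * ((1 + (1 + 2 * c) * w) / (1 - w) ^ 3)"

definition kernel_coeff :: "real \<Rightarrow> complex \<Rightarrow> nat \<Rightarrow> complex" where
  "kernel_coeff \<xi> c k = of_real (1 + \<xi> * real k) * ((1 + c) * of_nat k + 1)"

lemma has_field_derivative_over_square:
  fixes w :: complex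
  assumes p: "(p has_field_derivative p') (at w)" and w: "w \<noteq> 1"
  shows "((\<lambda>w. p w / (1 - w)\<^sup>2) has_field_derivative (p' * (1 - w) + 2 * p w) / (1 - w) ^ 3) (at w)"
proof -
  have nz: "(1 - w)\<^sup>2 \<noteq> 0" using w by simp
  have "((\<lambda>w. (1 - w)\<^sup>2) has_field_derivative (- (2 * (1 - w)))) (at w)"
    by (auto intro!: derivative_eq_intros)
  from DERIV_divide[OF p this nz]
  have "((\<lambda>w. p w / (1 - w)\<^sup>2) has_field_derivative
      (p' * (1 - w)\<^sup>2 - p w * (- (2 * (1 - w)))) / ((1 - w)\<^sup>2 * (1 - w)\<^sup>2)) (at w)" .
  also have "(p' * v\<^sup>2 - b * (- (2 * v))) / (v\<^sup>2 * v\<^sup>2) = (p' * v + 2 * b) / v ^ 3" if "v \<noteq> 0" for b v :: complex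
  proof -
    have "(p' * v\<^sup>2 - b * (- (2 * v))) / (v\<^sup>2 * v\<^sup>2) = ((p' * v + 2 * b) * v) / (v ^ 3 * v)"
      by (simp add: power2_eq_square power3_eq_cube algebra_simps)
    also have "\<dots> = (p' * v + 2 * b) / v ^ 3"
      using that by (rule mult_divide_mult_cancel_right)
    finally show ?thesis .
  qed
  from this[of "1 - w" "p w"] have "(p' * (1 - w)\<^sup>2 - p w * (- (2 * (1 - w)))) / ((1 - w)\<^sup>2 * (1 - w)\<^sup>2)
      = (p' * (1 - w) + 2 * p w) / (1 - w) ^ 3" using w by simp
  finally show ?thesis .
qed

text \<open>
  With \<open>u(w) = (1 + c w) / (1 - w)\<^sup>2\<close>, whose coefficients are \<open>(1 + c) k + 1\<close>, the kernel is \<open>u + \<xi> w u'\<close>.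
\<close>
lemma disc_series_pascu_kernel: "disc_series (kernel_coeff \<xi> c) (pascu_kernel \<xi> c)"
proof -
  have d1: "deriv (\<lambda>w. 1 / (1 - w)) w = 1 / (1 - w)\<^sup>2" if "norm w < 1" for w :: complex
    using that by (intro DERIV_imp_deriv) (auto intro!: derivative_eq_intros simp: power2_eq_square)
  have sq: "disc_series (\<lambda>k. of_nat (Suc k)) (\<lambda>w. 1 / (1 - w)\<^sup>2)"
    by (rule disc_series_cong[OF disc_series_deriv[OF disc_series_geometric]]) (auto simp: d1)
  define u where "u w = (1 + c * w) / (1 - w)\<^sup>2" for w
  have u: "disc_series (\<lambda>k. (1 + c) * of_nat k + 1) u"
  proof (rule disc_series_cong[OF disc_series_add[OF disc_series_cmult[OF sq, of "1 + c"] disc_series_cmult[OF disc_series_geometric, of "- c"]]])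
    fix w :: complex assume "norm w < 1"
    then have "1 - w \<noteq> 0" by auto
    then have e: "1 / (1 - w) = (1 - w) / (1 - w)\<^sup>2" by (simp add: power2_eq_square)
    have "(1 + c) * (1 / (1 - w)\<^sup>2) + - c * (1 / (1 - w)) = ((1 + c) - c * (1 - w)) / (1 - w)\<^sup>2"
      unfolding e by (simp add: divide_inverse algebra_simps)
    also have "(1 + c) - c * (1 - w) = 1 + c * w" by (simp add: algebra_simps)
    finally show "(1 + c) * (1 / (1 - w)\<^sup>2) + - c * (1 / (1 - w)) = u w"
      by (simp only: u_def)
  qed (simp add: algebra_simps)
  have du: "deriv u w = (c * (1 - w) + 2 * (1 + c * w)) / (1 - w) ^ 3" if "norm w < 1" for w
  proof (rule DERIV_imp_deriv)
    show "(u has_field_derivative (c * (1 - w) + 2 * (1 + c * w)) / (1 - w) ^ 3) (at w)"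
      unfolding u_def[abs_def] using that
      by (intro has_field_derivative_over_square) (auto intro!: derivative_eq_intros)
  qed
  show ?thesis
  proof (rule disc_series_cong[OF disc_series_add[OF u disc_series_cmult[OF disc_series_euler[OF u], of "of_real \<xi>"]]])
    show "(1 + c) * of_nat k + 1 + of_real \<xi> * (of_nat k * ((1 + c) * of_nat k + 1)) = kernel_coeff \<xi> c k" for k
      by (simp add: kernel_coeff_def algebra_simps)
    fix w :: complex assume w: "norm w < 1"
    then have nz: "1 - w \<noteq> 0" by auto
    have "u w = (1 + c * w) * (1 - w) / (1 - w) ^ 3"
      using nz by (simp add: u_def power2_eq_square power3_eq_cube)
    then have "(1 + (1 + 2 * c) * w) / (1 - w) ^ 3 - u w
        = ((1 + (1 + 2 * c) * w) - (1 + c * w) * (1 - w)) / (1 - w) ^ 3"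
      by (simp only: diff_divide_distrib)
    also have "(1 + (1 + 2 * c) * w) - (1 + c * w) * (1 - w) = w * (c * (1 - w) + 2 * (1 + c * w))"
      by (simp add: algebra_simps)
    also have "\<dots> / (1 - w) ^ 3 = w * deriv u w"
      unfolding du[OF w] by simp
    finally have "w * deriv u w = (1 + (1 + 2 * c) * w) / (1 - w) ^ 3 - u w" ..
    moreover have "a + x * (b - a) = (1 - x) * a + x * b" for a b x :: complex
      by (simp add: algebra_simps)
    ultimately show "u w + of_real \<xi> * (w * deriv u w) = pascu_kernel \<xi> c w"
      by (simp only: pascu_kernel_def u_def[symmetric] of_real_diff of_real_1)
  qed
qed

lemma h_fun_quot_id:
  "quot_id (h_fun \<sigma> \<epsilon>) w = (1 + conv_coeff \<sigma> \<epsilon> * w) / (1 - w)\<^sup>2"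
  and h_fun_deriv:
  "norm w < 1 \<Longrightarrow> deriv (h_fun \<sigma> \<epsilon>) w = (1 + (1 + 2 * conv_coeff \<sigma> \<epsilon>) * w) / (1 - w) ^ 3"
proof -
  let ?c = "conv_coeff \<sigma> \<epsilon>"
  have h: "h_fun \<sigma> \<epsilon> = (\<lambda>w. w * (1 + ?c * w) / (1 - w)\<^sup>2)"
    by (simp add: h_fun_def conv_coeff_def fun_eq_iff)
  have d: "deriv (h_fun \<sigma> \<epsilon>) w = (1 + (1 + 2 * ?c) * w) / (1 - w) ^ 3" if "norm w < 1" for w
  proof (rule DERIV_imp_deriv)
    have "((\<lambda>w. w * (1 + ?c * w)) has_field_derivative (1 + 2 * ?c * w)) (at w)"
      by (auto intro!: derivative_eq_intros simp: algebra_simps)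
    moreover have "w \<noteq> 1" using that by auto
    ultimately have "(h_fun \<sigma> \<epsilon> has_field_derivative ((1 + 2 * ?c * w) * (1 - w) + 2 * (w * (1 + ?c * w))) / (1 - w) ^ 3) (at w)"
      unfolding h by (rule has_field_derivative_over_square)
    also have "(1 + 2 * ?c * w) * (1 - w) + 2 * (w * (1 + ?c * w)) = 1 + (1 + 2 * ?c) * w"
      by (simp add: algebra_simps)
    finally show "(h_fun \<sigma> \<epsilon> has_field_derivative (1 + (1 + 2 * ?c) * w) / (1 - w) ^ 3) (at w)" .
  qed
  then show "norm w < 1 \<Longrightarrow> deriv (h_fun \<sigma> \<epsilon>) w = (1 + (1 + 2 * ?c) * w) / (1 - w) ^ 3" .
  show "quot_id (h_fun \<sigma> \<epsilon>) w = (1 + ?c * w) / (1 - w)\<^sup>2"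
    using d[of 0] by (cases "w = 0") (simp_all add: quot_id_def h)
qed

text \<open>
  The real function subtracted in \<open>L_fun\<close>. It is the kernel with \<open>\<epsilon> = 1\<close> at the point \<open>- t\<close>, that is, the
  value that \<open>z = -1\<close> would give (\<open>pascu_kernel_boundary\<close>).
\<close>
definition boundary_kernel :: "real \<Rightarrow> real \<Rightarrow> real \<Rightarrow> real" where
  "boundary_kernel \<sigma> \<xi> t = (1 - \<xi>) * ((1 - \<sigma> * (1 + t)) / ((1 - \<sigma>) * (1 + t)\<^sup>2))
     + \<xi> * ((1 - \<sigma> - (1 + \<sigma>) * t) / ((1 - \<sigma>) * (1 + t) ^ 3))"

lemma boundary_kernel_bdd:
  assumes "\<sigma> < 1"
  shows "bdd_borel (\<lambda>t. (1 - \<sigma> * (1 + t)) / ((1 - \<sigma>) * (1 + t)\<^sup>2))"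
    and "bdd_borel (\<lambda>t. (1 - \<sigma> - (1 + \<sigma>) * t) / ((1 - \<sigma>) * (1 + t) ^ 3))"
    and "bdd_borel (boundary_kernel \<sigma> \<xi>)"
proof -
  show *: "bdd_borel (\<lambda>t. (1 - \<sigma> * (1 + t)) / ((1 - \<sigma>) * (1 + t)\<^sup>2))"
    "bdd_borel (\<lambda>t. (1 - \<sigma> - (1 + \<sigma>) * t) / ((1 - \<sigma>) * (1 + t) ^ 3))"
    using assms by (auto intro!: bdd_borelI continuous_intros)
  show "bdd_borel (boundary_kernel \<sigma> \<xi>)"
    unfolding boundary_kernel_def[abs_def] by (rule bdd_borel_linear[OF *])
qed

lemma pascu_kernel_boundary:
  assumes "\<sigma> < 1" "0 \<le> t"
  shows "pascu_kernel \<xi> (conv_coeff \<sigma> 1) (- of_real t) = of_real (boundary_kernel \<sigma> \<xi> t)"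
proof -
  have s: "1 - \<sigma> \<noteq> 0" and t: "1 + t \<noteq> 0" using assms by auto
  have c: "conv_coeff \<sigma> 1 = of_real (\<sigma> / (1 - \<sigma>))"
  proof -
    have "conv_coeff \<sigma> 1 = of_real ((1 + (2 * \<sigma> - 1)) / (2 * (1 - \<sigma>)))"
      by (simp only: conv_coeff_def of_real_add of_real_divide of_real_1)
    also have "(1 + (2 * \<sigma> - 1)) / (2 * (1 - \<sigma>)) = \<sigma> / (1 - \<sigma>)"
      using mult_divide_mult_cancel_left[of 2 \<sigma> "1 - \<sigma>"] by simp
    finally show ?thesis .
  qed
  have e: "pascu_kernel \<xi> (conv_coeff \<sigma> 1) (- of_real t) =
    of_real ((1 - \<xi>) * ((1 - \<sigma> / (1 - \<sigma>) * t) / (1 + t)\<^sup>2) + \<xi> * ((1 - (1 + 2 * (\<sigma> / (1 - \<sigma>))) * t) / (1 + t) ^ 3))"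
    by (simp add: pascu_kernel_def c)
  have "(1 - \<sigma> / (1 - \<sigma>) * t) / (1 + t)\<^sup>2 = (1 - \<sigma> * (1 + t)) / ((1 - \<sigma>) * (1 + t)\<^sup>2)"
  proof -
    have "1 - \<sigma> / (1 - \<sigma>) * t = (1 - \<sigma> * (1 + t)) / (1 - \<sigma>)" using s by (simp add: field_simps)
    then show ?thesis by simp
  qed
  moreover have "(1 - (1 + 2 * (\<sigma> / (1 - \<sigma>))) * t) / (1 + t) ^ 3 = (1 - \<sigma> - (1 + \<sigma>) * t) / ((1 - \<sigma>) * (1 + t) ^ 3)"
  proof -
    have "1 - (1 + 2 * (\<sigma> / (1 - \<sigma>))) * t = (1 - \<sigma> - (1 + \<sigma>) * t) / (1 - \<sigma>)" using s by (simp add: field_simps)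
    then show ?thesis by simp
  qed
  ultimately show ?thesis unfolding e boundary_kernel_def by simp
qed

lemma L_fun_eq:
  assumes "norm z < 1" "t \<in> {0..1}"
  shows "L_fun \<sigma> \<xi> \<epsilon> z t = Re (pascu_kernel \<xi> (conv_coeff \<sigma> \<epsilon>) (of_real t * z)) - boundary_kernel \<sigma> \<xi> t"
proof -
  have "norm (of_real t * z) < 1"
    using assms mult_left_le_one_le[of "norm z" t] by (auto simp: norm_mult)
  note d = h_fun_deriv[OF this]
  have r: "Re (complex_of_real a * u) = a * Re u" for a u by simp
  show ?thesis
    unfolding L_fun_def boundary_kernel_def pascu_kernel_def h_fun_quot_id d plus_complex.sel r
    by (simp only: right_diff_distrib)
qed

text \<open>
  The parameters without \<open>\<beta>\<close>, which enters only through its relation to the number \<open>threshold\<close>.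
\<close>
locale pascu_setting =
  fixes \<sigma> \<xi> \<alpha> \<gamma> \<mu> \<nu> :: real and lam :: "real \<Rightarrow> real"
  assumes \<sigma>: "0 \<le> \<sigma>" "\<sigma> < 1"
    and \<mu>_nonneg: "0 \<le> \<mu>" and \<nu>_pos: "0 < \<nu>"
    and sum_eq: "\<mu> + \<nu> = \<alpha> - \<gamma>" and prod_eq: "\<mu> * \<nu> = \<gamma>"
    and lam_nonneg: "\<And>t. t \<in> {0..1} \<Longrightarrow> 0 \<le> lam t"
    and lam_int: "set_integrable lebesgue {0..1} lam"
    and lam_1: "(LINT t:{0..1}|lebesgue. lam t) = 1"
begin

definition norm_const :: real where "norm_const = (if \<gamma> > 0 then \<mu> * \<nu> else \<nu>)"

text \<open>
  For \<open>\<gamma> = 0\<close> one has \<open>\<mu> = 0\<close> and \<open>\<alpha> = \<nu>\<close>, and a single tail integral takes the place of the iterated one.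
\<close>
definition pi_density :: "real \<Rightarrow> real" where
  "pi_density t = (if \<gamma> > 0 then t powr (1 / \<mu> - 1) * Pi_fun lam \<mu> \<nu> t
     else t powr (1 / \<nu> - 1) * Lam_fun lam \<nu> t) / norm_const"

definition double_average :: "(real \<Rightarrow> real) \<Rightarrow> real \<Rightarrow> real" where
  "double_average \<phi> t = (if \<gamma> > 0 then averaging (1 / \<nu>) (averaging (1 / \<mu>) \<phi>) t
     else averaging (1 / \<nu>) \<phi> t) / norm_const"

lemma parameter_cases: "\<gamma> > 0 \<and> \<mu> > 0 \<or> \<gamma> = 0 \<and> \<mu> = 0 \<and> \<nu> = \<alpha>"
proof (cases "\<mu> = 0")
  case True
  then have "\<gamma> = 0" using prod_eq by simp
  then show ?thesis using True sum_eq by simp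
next
  case False
  then have "0 < \<mu>" using \<mu>_nonneg by simp
  then show ?thesis using \<nu>_pos prod_eq by (metis mult_pos_pos)
qed

lemma norm_const_pos: "0 < norm_const"
  using parameter_cases \<nu>_pos by (auto simp: norm_const_def)

lemma density_nonneg: "t \<in> {0..1} \<Longrightarrow> 0 \<le> pi_density t"
  unfolding pi_density_def using Pi_fun_nonneg[of lam t] Lam_fun_nonneg[of lam t] lam_nonneg norm_const_pos by auto

lemma density_integral:
  assumes \<phi>: "bdd_borel \<phi>"
  shows "set_integrable lebesgue {0..1} (\<lambda>t. pi_density t * \<phi> t)"
    and "(LINT t:{0..1}|lebesgue. pi_density t * \<phi> t) = (LINT t:{0..1}|lebesgue. lam t * double_average \<phi> t)"
proof -
  have "set_integrable lebesgue {0..1} (\<lambda>t. pi_density t * \<phi> t) \<and>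
    (LINT t:{0..1}|lebesgue. pi_density t * \<phi> t) = (LINT t:{0..1}|lebesgue. lam t * double_average \<phi> t)"
    using parameter_cases
  proof
    assume *: "\<gamma> > 0 \<and> \<mu> > 0"
    then have "0 < \<mu>" by simp
    note P = Pi_fun_weight[OF this \<nu>_pos lam_nonneg lam_int \<phi>]
    show ?thesis using P * by (simp add: pi_density_def double_average_def)
  next
    assume "\<gamma> = 0 \<and> \<mu> = 0 \<and> \<nu> = \<alpha>"
    then have "\<not> \<gamma> > 0" by simp
    with Lam_fun_weight[OF \<nu>_pos lam_nonneg lam_int \<phi>] show ?thesis
      by (simp add: pi_density_def double_average_def)
  qed
  then show "set_integrable lebesgue {0..1} (\<lambda>t. pi_density t * \<phi> t)"
    and "(LINT t:{0..1}|lebesgue. pi_density t * \<phi> t) = (LINT t:{0..1}|lebesgue. lam t * double_average \<phi> t)"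
    by auto
qed

lemma density_integrable: "set_integrable lebesgue {0..1} pi_density"
  using density_integral(1)[of "\<lambda>_. 1"] by (auto simp: bdd_borel_def)

definition moment :: "nat \<Rightarrow> real" where "moment k = (LINT t:{0..1}|lebesgue. lam t * t ^ k)"

lemma moment_0: "moment 0 = 1"
  by (simp add: moment_def lam_1)

lemma double_average_power:
  assumes "x \<in> {0..1}"
  shows "double_average (\<lambda>t. t ^ k) x = x ^ k / ((1 + \<mu> * k) * (1 + \<nu> * k))"
proof -
  have e: "1 / y + real k = (1 + y * k) / y" if "y > 0" for y using that by (simp add: field_simps)
  show ?thesis
    using parameter_cases
  proof
    assume *: "\<gamma> > 0 \<and> \<mu> > 0"
    have b: "bdd_borel (\<lambda>t::real. t ^ k)" by (intro bdd_borelI continuous_intros) auto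
    have "averaging (1 / \<mu>) (\<lambda>t. t ^ k) = (\<lambda>t. t ^ k / (1 / \<mu> + k))"
      using averaging_power[of "1 / \<mu>" k] * by (intro ext) simp
    then have "averaging (1 / \<nu>) (averaging (1 / \<mu>) (\<lambda>t. t ^ k)) x =
        averaging (1 / \<nu>) (\<lambda>t. (1 / (1 / \<mu> + k)) * t ^ k + 0 * t ^ k) x" by simp
    also have "\<dots> = (1 / (1 / \<mu> + k)) * averaging (1 / \<nu>) (\<lambda>t. t ^ k) x + 0 * averaging (1 / \<nu>) (\<lambda>t. t ^ k) x"
      by (rule averaging_linear) (use b assms \<nu>_pos in auto)
    also have "\<dots> = (1 / (1 / \<mu> + k)) * (x ^ k / (1 / \<nu> + k))"
      using averaging_power[of "1 / \<nu>" k x] \<nu>_pos by simp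
    finally show ?thesis
      using * \<nu>_pos by (simp add: double_average_def norm_const_def e)
  next
    assume "\<gamma> = 0 \<and> \<mu> = 0 \<and> \<nu> = \<alpha>"
    then have "\<not> \<gamma> > 0" "(1 + \<mu> * k) * (1 + \<nu> * k) = 1 + \<nu> * k" by simp_all
    then show ?thesis
      using averaging_power[of "1 / \<nu>" k x] \<nu>_pos by (simp only: double_average_def norm_const_def e if_False) simp
  qed
qed

text \<open>
  The two averages in \<open>double_average\<close> turn \<open>t\<^sup>k\<close> into \<open>t\<^sup>k / ((1 + \<mu> k) (1 + \<nu> k))\<close>. For \<open>k = 0\<close> this says that
  \<open>pi_density\<close> has total mass \<open>1\<close>.
\<close>
lemma density_moment:
  "(LINT t:{0..1}|lebesgue. pi_density t * t ^ k) = moment k / ((1 + \<mu> * k) * (1 + \<nu> * k))"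
proof -
  have b: "bdd_borel (\<lambda>t::real. t ^ k)" by (intro bdd_borelI continuous_intros) auto
  have "(LINT t:{0..1}|lebesgue. pi_density t * t ^ k)
     = (LINT t:{0..1}|lebesgue. lam t * t ^ k / ((1 + \<mu> * k) * (1 + \<nu> * k)))"
    unfolding density_integral(2)[OF b]
    by (rule set_lebesgue_integral_cong) (auto simp: double_average_power)
  also have "\<dots> = moment k / ((1 + \<mu> * k) * (1 + \<nu> * k))"
    unfolding moment_def by (rule set_integral_divide_zero)
  finally show ?thesis .
qed

definition threshold :: real where
  "threshold = (LINT t:{0..1}|lebesgue. pi_density t * boundary_kernel \<sigma> \<xi> t)"

lemma g_fun_average:
  assumes "0 < t" "t \<le> 1"
  shows "g_fun \<sigma> \<alpha> \<gamma> \<mu> \<nu> t = 2 * double_average (\<lambda>t. (1 - \<sigma> * (1 + t)) / ((1 - \<sigma>) * (1 + t)\<^sup>2)) t - 1"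
    and "q_fun \<sigma> \<alpha> \<gamma> \<mu> \<nu> t = double_average (\<lambda>t. (1 - \<sigma> - (1 + \<sigma>) * t) / ((1 - \<sigma>) * (1 + t) ^ 3)) t"
proof -
  have double: "(LINT w:{0..1}|lebesgue. LINT s:{0..1}|lebesgue. \<phi> (s * w * t) * s powr (1 / \<mu> - 1) * w powr (1 / \<nu> - 1))
      = averaging (1 / \<nu>) (averaging (1 / \<mu>) \<phi>) t"
    if \<gamma>: "\<gamma> > 0" and \<phi>: "bdd_borel \<phi>" for \<phi>
  proof -
    have \<mu>: "0 < 1 / \<mu>" using \<gamma> parameter_cases by auto
    have [measurable]: "\<phi> \<in> borel_measurable borel" "averaging (1 / \<mu>) \<phi> \<in> borel_measurable borel"
      using \<phi> bdd_borel_averaging[OF \<mu> \<phi>] by (auto simp: bdd_borel_def)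
    have inner: "(LINT s:{0..1}|lebesgue. \<phi> (s * w * t) * s powr (1 / \<mu> - 1) * w powr (1 / \<nu> - 1))
       = averaging (1 / \<mu>) \<phi> (w * t) * w powr (1 / \<nu> - 1)" for w
    proof -
      have "(LINT s:{0..1}|lebesgue. \<phi> (s * w * t) * s powr (1 / \<mu> - 1))
        = (LINT s:{0..1}|lborel. \<phi> (s * w * t) * s powr (1 / \<mu> - 1))"
        by (rule lebesgue_eq_lborel_integral(1)) auto
      then show ?thesis unfolding averaging_def mult.assoc[of _ w t, symmetric]
        by (simp only: set_integral_mult_left)
    qed
    have "(LINT w:{0..1}|lebesgue. LINT s:{0..1}|lebesgue. \<phi> (s * w * t) * s powr (1 / \<mu> - 1) * w powr (1 / \<nu> - 1))
      = (LINT w:{0..1}|lebesgue. averaging (1 / \<mu>) \<phi> (w * t) * w powr (1 / \<nu> - 1))"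
      unfolding inner ..
    also have "\<dots> = (LINT w:{0..1}|lborel. averaging (1 / \<mu>) \<phi> (w * t) * w powr (1 / \<nu> - 1))"
      by (rule lebesgue_eq_lborel_integral(1)) auto
    finally show ?thesis by (simp add: averaging_def)
  qed
  have single: "t powr (- (1 / \<nu>)) * (LINT s:{0..t}|lebesgue. \<phi> s * s powr (1 / \<nu> - 1)) = averaging (1 / \<nu>) \<phi> t"
    if \<phi>: "bdd_borel \<phi>" for \<phi>
  proof -
    have \<nu>: "0 < 1 / \<nu>" using \<nu>_pos by simp
    have [measurable]: "\<phi> \<in> borel_measurable borel" using \<phi> by (auto simp: bdd_borel_def)
    have "(LINT s:{0..t}|lebesgue. \<phi> s * s powr (1 / \<nu> - 1)) = (LINT s:{0..t}|lborel. \<phi> s * s powr (1 / \<nu> - 1))"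
      by (rule lebesgue_eq_lborel_integral(1)) auto
    then show ?thesis
      using assms by (simp add: averaging_scale[OF assms(1) \<nu>] mult.assoc[symmetric] powr_add[symmetric])
  qed
  have \<alpha>: "\<alpha> = \<nu>" if "\<not> \<gamma> > 0" using parameter_cases that by auto
  note b = boundary_kernel_bdd(1,2)[OF \<sigma>(2)]
  show "g_fun \<sigma> \<alpha> \<gamma> \<mu> \<nu> t = 2 * double_average (\<lambda>t. (1 - \<sigma> * (1 + t)) / ((1 - \<sigma>) * (1 + t)\<^sup>2)) t - 1"
    using double[OF _ b(1)] single[OF b(1)] \<alpha>
    by (cases "\<gamma> > 0") (simp_all add: g_fun_def double_average_def norm_const_def mult.assoc)
  show "q_fun \<sigma> \<alpha> \<gamma> \<mu> \<nu> t = double_average (\<lambda>t. (1 - \<sigma> - (1 + \<sigma>) * t) / ((1 - \<sigma>) * (1 + t) ^ 3)) t"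
    using double[OF _ b(2)] single[OF b(2)] \<alpha>
    by (cases "\<gamma> > 0") (simp_all add: q_fun_def double_average_def norm_const_def mult.assoc)
qed

lemma double_average_linear:
  assumes "bdd_borel \<phi>" "bdd_borel \<psi>" "0 \<le> x" "x \<le> 1"
  shows "double_average (\<lambda>t. c * \<phi> t + d * \<psi> t) x = c * double_average \<phi> x + d * double_average \<psi> x"
  using parameter_cases
proof
  assume *: "\<gamma> > 0 \<and> \<mu> > 0"
  then have \<mu>: "0 < 1 / \<mu>" and \<nu>: "0 < 1 / \<nu>" using \<nu>_pos by auto
  have "averaging (1 / \<nu>) (averaging (1 / \<mu>) (\<lambda>t. c * \<phi> t + d * \<psi> t)) x =
     averaging (1 / \<nu>) (\<lambda>t. c * averaging (1 / \<mu>) \<phi> t + d * averaging (1 / \<mu>) \<psi> t) x"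
    by (rule averaging_cong) (use assms \<mu> in \<open>auto intro!: averaging_linear\<close>)
  also have "\<dots> = c * averaging (1 / \<nu>) (averaging (1 / \<mu>) \<phi>) x + d * averaging (1 / \<nu>) (averaging (1 / \<mu>) \<psi>) x"
    by (rule averaging_linear[OF \<nu>]) (use assms \<mu> in \<open>auto intro!: bdd_borel_averaging\<close>)
  finally show ?thesis using * by (simp add: double_average_def add_divide_distrib)
next
  assume "\<gamma> = 0 \<and> \<mu> = 0 \<and> \<nu> = \<alpha>"
  then have "\<not> \<gamma> > 0" by simp
  moreover have "0 < 1 / \<nu>" using \<nu>_pos by simp
  ultimately show ?thesis
    using averaging_linear[OF _ assms] by (simp add: double_average_def add_divide_distrib)
qed

text \<open>
  By \<open>g_fun_average\<close> the combination of \<open>g_fun\<close> and \<open>q_fun\<close> that determines \<open>\<beta>\<close> is \<open>2 D - 1\<close>, where \<open>D\<close> is the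
  double average of the boundary kernel, so its integral against \<open>lam\<close> is \<open>2 threshold - 1\<close>.
\<close>
lemma threshold_eq:
  assumes \<beta>: "\<beta> < 1"
    and eq: "\<beta> / (1 - \<beta>) = - (LINT t:{0..1}|lebesgue.
           lam t * ((1 - \<xi>) * g_fun \<sigma> \<alpha> \<gamma> \<mu> \<nu> t + \<xi> * (2 * q_fun \<sigma> \<alpha> \<gamma> \<mu> \<nu> t - 1)))"
  shows "threshold = 1 - 1 / (2 * (1 - \<beta>))"
proof -
  let ?B = "boundary_kernel \<sigma> \<xi>"
  note b = boundary_kernel_bdd[OF \<sigma>(2)]
  have int: "set_integrable lebesgue {0..1} (\<lambda>t. lam t * double_average ?B t)"
  proof -
    have \<nu>: "0 < 1 / \<nu>" and \<mu>: "0 < \<gamma> \<Longrightarrow> 0 < 1 / \<mu>"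
      using parameter_cases \<nu>_pos by auto
    have bd: "bdd_borel (double_average ?B)"
    proof -
      have "bdd_borel (if \<gamma> > 0 then averaging (1 / \<nu>) (averaging (1 / \<mu>) ?B) else averaging (1 / \<nu>) ?B)"
        using \<nu> \<mu> b(3) by (auto intro!: bdd_borel_averaging)
      from bdd_borel_linear[OF this this, of "1 / norm_const" 0]
      show ?thesis by (simp add: double_average_def[abs_def] if_distrib[of "\<lambda>f. f _"] cong: if_cong)
    qed
    then obtain C where C: "\<And>t. t \<in> {0..1} \<Longrightarrow> \<bar>double_average ?B t\<bar> \<le> C"
      and [measurable]: "double_average ?B \<in> borel_measurable borel" unfolding bdd_borel_def by blast
    have [measurable]: "double_average ?B \<in> borel_measurable lebesgue"
      "(\<lambda>x. indicator {0..1} x *\<^sub>R lam x) \<in> borel_measurable lebesgue"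
      using lam_int by (auto simp: measurable_completion set_integrable_def)
    have "integrable lebesgue (\<lambda>t. C * (indicator {0..1} t *\<^sub>R lam t))"
      using lam_int unfolding set_integrable_def by (rule integrable_mult_right)
    then show ?thesis unfolding set_integrable_def
    proof (rule Bochner_Integration.integrable_bound)
      have "(\<lambda>t. (indicator {0..1} t *\<^sub>R lam t) * double_average ?B t) \<in> borel_measurable lebesgue"
        by measurable
      then show "(\<lambda>t. indicator {0..1} t *\<^sub>R (lam t * double_average ?B t)) \<in> borel_measurable lebesgue"
        by (simp add: mult.assoc)
      show "AE t in lebesgue. norm (indicator {0..1} t *\<^sub>R (lam t * double_average ?B t)) \<le> norm (C * (indicator {0..1} t *\<^sub>R lam t))"
      proof (rule AE_I2)
        fix t :: real
        show "norm (indicator {0..1} t *\<^sub>R (lam t * double_average ?B t)) \<le> norm (C * (indicator {0..1} t *\<^sub>R lam t))"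
          using order_trans[OF C abs_ge_self, of t]
          by (cases "t \<in> {0..1}") (auto simp: abs_mult mult.commute[of "\<bar>C\<bar>"] intro!: mult_left_mono)
      qed
    qed
  qed
  have "(LINT t:{0..1}|lebesgue. lam t * ((1 - \<xi>) * g_fun \<sigma> \<alpha> \<gamma> \<mu> \<nu> t + \<xi> * (2 * q_fun \<sigma> \<alpha> \<gamma> \<mu> \<nu> t - 1)))
     = (LINT t:{0..1}|lebesgue. 2 * (lam t * double_average ?B t) - lam t)"
  proof (rule set_lebesgue_integral_cong_off_0)
    fix t :: real assume t: "t \<in> {0..1}" "t \<noteq> 0"
    define k1 where "k1 t = (1 - \<sigma> * (1 + t)) / ((1 - \<sigma>) * (1 + t)\<^sup>2)" for t
    define k2 where "k2 t = (1 - \<sigma> - (1 + \<sigma>) * t) / ((1 - \<sigma>) * (1 + t) ^ 3)" for t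
    have B: "double_average ?B t = (1 - \<xi>) * double_average k1 t + \<xi> * double_average k2 t"
      unfolding boundary_kernel_def[abs_def] k1_def[symmetric] k2_def[symmetric]
      using t b(1,2) by (intro double_average_linear) (auto simp: k1_def[abs_def] k2_def[abs_def])
    have gq: "g_fun \<sigma> \<alpha> \<gamma> \<mu> \<nu> t = 2 * double_average k1 t - 1" "q_fun \<sigma> \<alpha> \<gamma> \<mu> \<nu> t = double_average k2 t"
      using g_fun_average[of t] t unfolding k1_def[abs_def] k2_def[abs_def] by auto
    show "lam t * ((1 - \<xi>) * g_fun \<sigma> \<alpha> \<gamma> \<mu> \<nu> t + \<xi> * (2 * q_fun \<sigma> \<alpha> \<gamma> \<mu> \<nu> t - 1))
      = 2 * (lam t * double_average ?B t) - lam t"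
      unfolding B gq by (simp add: algebra_simps)
  qed
  also have "\<dots> = 2 * threshold - 1"
    using int lam_int by (simp add: set_integral_diff(2) threshold_def density_integral(2)[OF b(3)] lam_1)
  finally have "\<beta> / (1 - \<beta>) = 1 - 2 * threshold" using eq by simp
  then show ?thesis using \<beta> by (simp add: field_simps)
qed

end

section \<open>From the transform to Hadamard products\<close>

context pascu_setting
begin

text \<open>
  The analytic function whose real part is the first term of \<open>M_fun\<close>, after normalisation.
\<close>
definition Psi :: "complex \<Rightarrow> complex \<Rightarrow> complex" where
  "Psi \<epsilon> z = (LINT t:{0..1}|lebesgue. of_real (pi_density t) * pascu_kernel \<xi> (conv_coeff \<sigma> \<epsilon>) (of_real t * z))"

definition Psi_coeff :: "complex \<Rightarrow> nat \<Rightarrow> complex" where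
  "Psi_coeff \<epsilon> k = kernel_coeff \<xi> (conv_coeff \<sigma> \<epsilon>) k * of_real (moment k / ((1 + \<mu> * k) * (1 + \<nu> * k)))"

lemma of_real_measurable_lebesgue: "complex_of_real \<in> borel_measurable lebesgue"
  by (intro measurable_completion) simp

text \<open>
  The special case of dilations in \<open>disc_series_integral\<close>. It computes both the transform and \<open>Psi\<close>.
\<close>
lemma disc_series_weighted:
  assumes f: "disc_series a f" and w: "set_integrable lebesgue {0..1} w"
  shows "disc_series (\<lambda>k. a k * of_real (LINT t:{0..1}|lebesgue. w t * t ^ k))
     (\<lambda>z. LINT t:{0..1}|lebesgue. of_real (w t) * f (of_real t * z))"
    and "norm z < 1 \<Longrightarrow> set_integrable lebesgue {0..1} (\<lambda>t. of_real (w t) * f (of_real t * z))"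
proof -
  have w': "set_integrable lebesgue {0..1} (\<lambda>t. complex_of_real (w t))"
    using integrable_of_real[OF w[unfolded set_integrable_def], where 'a = complex]
    by (simp add: set_integrable_def scaleR_conv_of_real)
  note I = disc_series_integral[OF f _ w' of_real_measurable_lebesgue]
  show "norm z < 1 \<Longrightarrow> set_integrable lebesgue {0..1} (\<lambda>t. of_real (w t) * f (of_real t * z))"
    by (rule I(1)) auto
  have "(LINT t:{0..1}|lebesgue. complex_of_real (w t) * of_real t ^ k) = of_real (LINT t:{0..1}|lebesgue. w t * t ^ k)" for k
    using set_integral_complex_of_real[of lebesgue "{0..1}" "\<lambda>t. w t * t ^ k"] by simp
  then show "disc_series (\<lambda>k. a k * of_real (LINT t:{0..1}|lebesgue. w t * t ^ k))
     (\<lambda>z. LINT t:{0..1}|lebesgue. of_real (w t) * f (of_real t * z))"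
    using I(2) unfolding disc_series_def by simp
qed

lemma disc_series_Psi: "disc_series (Psi_coeff \<epsilon>) (Psi \<epsilon>)"
  using disc_series_weighted(1)[OF disc_series_pascu_kernel density_integrable]
  unfolding Psi_def[abs_def] Psi_coeff_def[abs_def] density_moment .

lemma Psi_coeff_0: "Psi_coeff \<epsilon> 0 = 1"
  by (simp add: Psi_coeff_def kernel_coeff_def moment_0)

lemma Psi_0: "Psi \<epsilon> 0 = 1"
  using disc_series_0[OF disc_series_Psi] Psi_coeff_0 by simp

lemma Re_Psi:
  assumes "norm z < 1"
  shows "Re (Psi \<epsilon> z) = (LINT t:{0..1}|lebesgue. pi_density t * Re (pascu_kernel \<xi> (conv_coeff \<sigma> \<epsilon>) (of_real t * z)))"
    and "set_integrable lebesgue {0..1} (\<lambda>t. pi_density t * Re (pascu_kernel \<xi> (conv_coeff \<sigma> \<epsilon>) (of_real t * z)))"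
proof -
  note I = disc_series_weighted(2)[OF disc_series_pascu_kernel[of \<xi> "conv_coeff \<sigma> \<epsilon>"] density_integrable assms, unfolded set_integrable_def]
  show "Re (Psi \<epsilon> z) = (LINT t:{0..1}|lebesgue. pi_density t * Re (pascu_kernel \<xi> (conv_coeff \<sigma> \<epsilon>) (of_real t * z)))"
    using integral_Re[OF I] by (simp add: Psi_def set_lebesgue_integral_def)
  show "set_integrable lebesgue {0..1} (\<lambda>t. pi_density t * Re (pascu_kernel \<xi> (conv_coeff \<sigma> \<epsilon>) (of_real t * z)))"
    using integrable_Re[OF I] by (simp add: set_integrable_def)
qed

lemma M_fun_eq:
  assumes z: "norm z < 1"
  shows "M_fun lam \<sigma> \<xi> \<alpha> \<gamma> \<mu> \<nu> \<epsilon> z = norm_const * (Re (Psi \<epsilon> z) - threshold)"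
proof -
  let ?k = "\<lambda>t. Re (pascu_kernel \<xi> (conv_coeff \<sigma> \<epsilon>) (of_real t * z))"
  have "M_fun lam \<sigma> \<xi> \<alpha> \<gamma> \<mu> \<nu> \<epsilon> z = (LINT t:{0..1}|lebesgue. norm_const * (pi_density t * L_fun \<sigma> \<xi> \<epsilon> z t))"
  proof (cases "\<gamma> > 0")
    case True
    then show ?thesis using norm_const_pos by (simp add: M_fun_def pi_density_def)
  next
    case False
    then have "\<alpha> = \<nu>" using parameter_cases by auto
    then show ?thesis using False norm_const_pos by (simp add: M_fun_def pi_density_def Pi_fun_def)
  qed
  also have "\<dots> = norm_const * (LINT t:{0..1}|lebesgue. pi_density t * L_fun \<sigma> \<xi> \<epsilon> z t)"
    by (rule set_integral_mult_right)
  also have "(LINT t:{0..1}|lebesgue. pi_density t * L_fun \<sigma> \<xi> \<epsilon> z t)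
    = (LINT t:{0..1}|lebesgue. pi_density t * ?k t - pi_density t * boundary_kernel \<sigma> \<xi> t)"
    by (rule set_lebesgue_integral_cong) (auto simp: L_fun_eq[OF z] right_diff_distrib)
  also have "\<dots> = Re (Psi \<epsilon> z) - threshold"
    unfolding Re_Psi(1)[OF z] threshold_def
    by (rule set_integral_diff(2)[OF Re_Psi(2)[OF z] density_integral(1)[OF boundary_kernel_bdd(3)[OF \<sigma>(2)]]])
  finally show ?thesis .
qed

text \<open>
  The function \<open>\<xi> z F' + (1 - \<xi>) F\<close> for \<open>F = V_transform lam f\<close>, whose starlikeness is the Pascu condition on \<open>F\<close>.
\<close>
definition image_op :: "(complex \<Rightarrow> complex) \<Rightarrow> complex \<Rightarrow> complex" where
  "image_op f z = of_real \<xi> * z * deriv (V_transform lam f) z + of_real (1 - \<xi>) * V_transform lam f z"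

definition W_op :: "(complex \<Rightarrow> complex) \<Rightarrow> complex \<Rightarrow> complex" where
  "W_op f z = of_real (1 - \<alpha> + 2 * \<gamma>) * quot_id f z + of_real (\<alpha> - 2 * \<gamma>) * deriv f z
     + of_real \<gamma> * z * deriv (deriv f) z"

lemma class_W_eq:
  "class_W \<beta> \<alpha> \<gamma> = {f \<in> class_A. \<exists>\<phi>::real. \<forall>z\<in>ball 0 1. 0 < Re (cis \<phi> * (W_op f z - of_real \<beta>))}"
  by (simp add: class_W_def W_op_def)

lemma class_A_series:
  assumes "f \<in> class_A"
  obtains a where "disc_series a f" "a 0 = 0" "a 1 = 1"
proof -
  obtain a where a: "disc_series a f" using disc_series_exists assms by (auto simp: class_A_def)
  then show ?thesis
    using disc_series_0[OF a] disc_series_0[OF disc_series_deriv[OF a]] assms that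
    by (simp add: class_A_def)
qed

lemma class_A_I:
  assumes a: "disc_series a f" "a 0 = 0" "a 1 = 1"
  shows "f \<in> class_A"
  using disc_series_0[OF a(1)] disc_series_0[OF disc_series_deriv[OF a(1)]] disc_series_holomorphic[OF a(1)] a
  by (simp add: class_A_def)

text \<open>
  The relations \<open>\<mu> + \<nu> = \<alpha> - \<gamma>\<close> and \<open>\<mu> \<nu> = \<gamma>\<close> are chosen to make the symbol of the operator factor as
  \<open>(1 + \<mu> k) (1 + \<nu> k)\<close>.
\<close>
lemma disc_series_W_op:
  assumes a: "disc_series a f" "a 0 = 0"
  shows "disc_series (\<lambda>k. of_real ((1 + \<mu> * k) * (1 + \<nu> * k)) * a (Suc k)) (W_op f)"
proof (rule disc_series_cong[OF disc_series_add[OF disc_series_add[OF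
      disc_series_cmult[OF disc_series_quot_id[OF a], of "of_real (1 - \<alpha> + 2 * \<gamma>)"]
      disc_series_cmult[OF disc_series_deriv[OF a(1)], of "of_real (\<alpha> - 2 * \<gamma>)"]]
      disc_series_cmult[OF disc_series_euler[OF disc_series_deriv[OF a(1)]], of "of_real \<gamma>"]]])
  fix k :: nat
  have *: "1 - \<alpha> + 2 * \<gamma> + (\<alpha> - 2 * \<gamma>) * real (Suc k) + \<gamma> * (real k * real (Suc k)) = (1 + \<mu> * k) * (1 + \<nu> * k)"
  proof -
    have \<alpha>: "\<alpha> = \<mu> + \<nu> + \<gamma>" using sum_eq by simp
    show ?thesis unfolding \<alpha> by (simp add: algebra_simps flip: prod_eq)
  qed
  show "of_real (1 - \<alpha> + 2 * \<gamma>) * a (Suc k) + of_real (\<alpha> - 2 * \<gamma>) * (of_nat (Suc k) * a (Suc k))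
      + of_real \<gamma> * (of_nat k * (of_nat (Suc k) * a (Suc k))) = of_real ((1 + \<mu> * k) * (1 + \<nu> * k)) * a (Suc k)"
    unfolding *[symmetric] by (simp add: algebra_simps)
qed (simp add: W_op_def)

lemma V_transform_series:
  assumes a: "disc_series a f" "a 0 = 0"
  shows "disc_series (\<lambda>n. a n * of_real (moment (n - 1))) (V_transform lam f)"
proof -
  let ?g = "\<lambda>z. LINT t:{0..1}|lebesgue. of_real (lam t) * quot_id f (of_real t * z)"
  have g: "disc_series (\<lambda>k. a (Suc k) * of_real (moment k)) ?g"
    using disc_series_weighted(1)[OF disc_series_quot_id[OF a] lam_int] by (simp add: moment_def)
  have f0: "f 0 = 0" using disc_series_0[OF a(1)] a(2) by simp
  show ?thesis
  proof (rule disc_series_cong[OF disc_series_shift[OF g]])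
    show "(case n of 0 \<Rightarrow> 0 | Suc k \<Rightarrow> a (Suc k) * of_real (moment k)) = a n * of_real (moment (n - 1))" for n
      using a(2) by (cases n) auto
    fix z :: complex
    have "z * ?g z = (LINT t:{0..1}|lebesgue. z * (of_real (lam t) * quot_id f (of_real t * z)))"
      by (rule set_integral_mult_right[symmetric])
    also have "\<dots> = V_transform lam f z"
      unfolding V_transform_def
    proof (rule set_lebesgue_integral_cong_off_0)
      fix t :: real assume "t \<noteq> 0"
      then show "z * (of_real (lam t) * quot_id f (of_real t * z)) = of_real (lam t) * (f (of_real t * z) / of_real t)"
        using f0 by (cases "z = 0") (simp_all add: quot_id_def)
    qed
    finally show "z * ?g z = V_transform lam f z" .
  qed
qed

lemma image_op_series:
  assumes a: "disc_series a f" "a 0 = 0"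
  shows "disc_series (\<lambda>n. of_real (1 + \<xi> * (real n - 1)) * a n * of_real (moment (n - 1))) (image_op f)"
proof -
  note V = V_transform_series[OF a]
  show ?thesis
    by (rule disc_series_cong[OF disc_series_add[OF disc_series_cmult[OF disc_series_euler[OF V], of "of_real \<xi>"]
          disc_series_cmult[OF V, of "of_real (1 - \<xi>)"]]])
       (simp_all add: image_op_def algebra_simps)
qed

lemma
  assumes f: "f \<in> class_A"
  shows V_transform_class_A: "V_transform lam f \<in> class_A"
    and image_op_class_A: "image_op f \<in> class_A"
proof -
  obtain a where a: "disc_series a f" "a 0 = 0" "a 1 = 1" using class_A_series[OF f] .
  show "V_transform lam f \<in> class_A" "image_op f \<in> class_A"
    by (rule class_A_I[OF V_transform_series[OF a(1,2)]], use a moment_0 in simp_all)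
       (rule class_A_I[OF image_op_series[OF a(1,2)]], use a moment_0 in simp_all)
qed

text \<open>
  The numerator in the Pascu condition is \<open>z\<close> times the derivative of the denominator.
\<close>
lemma pascu_iff:
  assumes f: "f \<in> class_A"
  shows "V_transform lam f \<in> pascu \<sigma> \<xi> \<longleftrightarrow>
    (\<forall>z\<in>ball 0 1 - {0}. \<sigma> < Re (z * deriv (image_op f) z / image_op f z))"
proof -
  let ?F = "V_transform lam f"
  have F: "?F holomorphic_on ball 0 1" using V_transform_class_A[OF f] by (simp add: class_A_def)
  have "of_real \<xi> * z * deriv (\<lambda>w. w * deriv ?F w) z + of_real (1 - \<xi>) * z * deriv ?F z
      = z * deriv (image_op f) z" if z: "z \<in> ball 0 1" for z
  proof -
    have hol: "(\<lambda>w. w * deriv ?F w) holomorphic_on ball 0 1"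
      by (intro holomorphic_intros F) auto
    have "((\<lambda>w. of_real \<xi> * (w * deriv ?F w) + of_real (1 - \<xi>) * ?F w) has_field_derivative
        (of_real \<xi> * deriv (\<lambda>w. w * deriv ?F w) z + of_real (1 - \<xi>) * deriv ?F z)) (at z)"
      by (intro DERIV_add DERIV_cmult holomorphic_derivI[OF hol _ z] holomorphic_derivI[OF F _ z]) auto
    then have "deriv (image_op f) z = of_real \<xi> * deriv (\<lambda>w. w * deriv ?F w) z + of_real (1 - \<xi>) * deriv ?F z"
      by (intro DERIV_imp_deriv) (simp add: image_op_def[abs_def] mult.assoc)
    then show ?thesis by (simp only: distrib_left mult_ac)
  qed
  then show ?thesis
    using V_transform_class_A[OF f] by (auto simp: pascu_def image_op_def)
qed

lemma pascu_iff_starlike: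
  assumes f: "f \<in> class_A"
  shows "V_transform lam f \<in> pascu \<sigma> \<xi> \<longleftrightarrow> image_op f \<in> starlike_order \<sigma>"
proof -
  have G: "image_op f \<in> class_A" by (rule image_op_class_A[OF f])
  have "inj_on (image_op f) (ball 0 1)"
    if "\<forall>z\<in>ball 0 1 - {0}. \<sigma> < Re (z * deriv (image_op f) z / image_op f z)"
    using G that \<sigma> by (intro starlike_univalent) (auto simp: class_A_def intro: le_less_trans)
  then show ?thesis unfolding pascu_iff[OF f] using G by (auto simp: starlike_order_def class_S_def)
qed

text \<open>
  At degree \<open>k + 1\<close> the coefficient of \<open>(1 + c) z G' - c G\<close> is
  \<open>((1 + c) k + 1) (1 + \<xi> k) \<tau>\<^sub>k a\<^sub>k\<^sub>+\<^sub>1\<close>, where \<open>\<tau>\<^sub>k\<close> is the \<open>k\<close>-th moment of \<open>lam\<close>. The factors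
  \<open>(1 + \<mu> k) (1 + \<nu> k)\<close> of \<open>b\<^sub>k\<close> cancel against those of \<open>Psi_coeff\<close>.
\<close>
lemma pascu_convolution:
  assumes a: "disc_series a f" "a 0 = 0" "a 1 = 1" and b: "disc_series b (W_op f)"
    and Q: "\<And>\<epsilon>. disc_series (\<lambda>k. b k * Psi_coeff \<epsilon> k) (Q \<epsilon>)"
  shows "V_transform lam f \<in> pascu \<sigma> \<xi> \<longleftrightarrow>
    (\<forall>z\<in>ball 0 1 - {0}. \<forall>\<epsilon>. norm \<epsilon> = 1 \<longrightarrow> Q \<epsilon> z \<noteq> 0)"
proof -
  let ?G = "image_op f"
  have f: "f \<in> class_A" by (rule class_A_I[OF a])
  have G: "?G holomorphic_on ball 0 1" "?G 0 = 0" "deriv ?G 0 = 1"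
    using image_op_class_A[OF f] by (auto simp: class_A_def)
  have beq: "b = (\<lambda>k. of_real ((1 + \<mu> * k) * (1 + \<nu> * k)) * a (Suc k))"
    by (rule disc_series_unique[OF b disc_series_W_op[OF a(1,2)]]) simp
  have "(1 + conv_coeff \<sigma> \<epsilon>) * (z * deriv ?G z) - conv_coeff \<sigma> \<epsilon> * ?G z = z * Q \<epsilon> z"
    if z: "norm z < 1" for z \<epsilon>
  proof -
    define c where "c = conv_coeff \<sigma> \<epsilon>"
    note S = image_op_series[OF a(1,2)]
    have D: "disc_series (\<lambda>n. case n of 0 \<Rightarrow> 0 | Suc k \<Rightarrow> b k * Psi_coeff \<epsilon> k)
        (\<lambda>z. (1 + c) * (z * deriv ?G z) + (- c) * ?G z)"
    proof (rule disc_series_cong[OF disc_series_add[OF disc_series_cmult[OF disc_series_euler[OF S], of "1 + c"]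
           disc_series_cmult[OF S, of "- c"]]])
      fix n
      show "(1 + c) * (of_nat n * (of_real (1 + \<xi> * (real n - 1)) * a n * of_real (moment (n - 1))))
         + - c * (of_real (1 + \<xi> * (real n - 1)) * a n * of_real (moment (n - 1)))
         = (case n of 0 \<Rightarrow> 0 | Suc k \<Rightarrow> b k * Psi_coeff \<epsilon> k)"
      proof (cases n)
        case (Suc k)
        define m where "m = (1 + \<mu> * k) * (1 + \<nu> * k)"
        have "0 < 1 + \<mu> * k" "0 < 1 + \<nu> * k"
          using \<mu>_nonneg \<nu>_pos by (auto intro: add_pos_nonneg)
        then have m: "complex_of_real m \<noteq> 0" unfolding of_real_eq_0_iff m_def by simp
        have "b k * Psi_coeff \<epsilon> k = kernel_coeff \<xi> c k * a (Suc k) * of_real (moment k)"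
          using m unfolding beq Psi_coeff_def m_def[symmetric] c_def[symmetric] by simp
        then show ?thesis unfolding Suc kernel_coeff_def by (simp add: algebra_simps)
      qed (simp add: a)
    qed simp
    show ?thesis
      using sums_unique2[OF disc_seriesD[OF D z] disc_seriesD[OF disc_series_shift[OF Q] z]]
      by (simp add: c_def)
  qed
  then show ?thesis
    unfolding pascu_iff[OF f] starlike_convolution_criterion[OF G \<sigma>] by auto
qed

text \<open>
  Only the convergence of the Hadamard product needs work before \<open>half_plane_nonvanishing\<close> applies. The
  product is obtained from \<open>F(z) / z\<close>, where \<open>F\<close> is the transform of \<open>f\<close>, by two operators of the form
  \<open>1 + d z d/dz\<close>, hence it is a power series on the disk.
\<close>
lemma image_in_pascu:
  assumes \<beta>: "\<beta> < 1" and f: "f \<in> class_W \<beta> \<alpha> \<gamma>"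
    and ge: "\<And>\<epsilon> z. norm \<epsilon> = 1 \<Longrightarrow> norm z < 1 \<Longrightarrow> 1 - 1 / (2 * (1 - \<beta>)) \<le> Re (Psi \<epsilon> z)"
  shows "V_transform lam f \<in> pascu \<sigma> \<xi>"
proof -
  obtain \<phi> where fA: "f \<in> class_A"
    and "\<forall>z\<in>ball 0 1. 0 < Re (cis \<phi> * (W_op f z - of_real \<beta>))"
    using f unfolding class_W_eq by blast
  then have \<phi>: "0 < Re (cis \<phi> * (W_op f z - of_real \<beta>))" if "norm z < 1" for z
    using that by (simp only: mem_ball_0)
  obtain a where a: "disc_series a f" "a 0 = 0" "a 1 = 1" using class_A_series[OF fA] .
  define b where "b k = of_real ((1 + \<mu> * k) * (1 + \<nu> * k)) * a (Suc k)" for k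
  have b: "disc_series b (W_op f)" using disc_series_W_op[OF a(1,2)] by (simp add: b_def[abs_def])
  have b0: "b 0 = 1" using a(3) by (simp add: b_def)
  have pd: "0 < 1 + \<mu> * k" "0 < 1 + \<nu> * k" for k :: nat
    using \<mu>_nonneg \<nu>_pos by (auto intro: add_pos_nonneg)
  define Q where "Q \<epsilon> z = (\<Sum>k. b k * Psi_coeff \<epsilon> k * z ^ k)" for \<epsilon> z
  have Q: "disc_series (\<lambda>k. b k * Psi_coeff \<epsilon> k) (Q \<epsilon>)" for \<epsilon>
  proof -
    have D: "disc_series (\<lambda>n. a (Suc n) * of_real (moment n)) (quot_id (V_transform lam f))"
      using disc_series_quot_id[OF V_transform_series[OF a(1,2)]] a(2) by simp
    have E: "disc_series (\<lambda>n. c * (of_nat n * g n) + g n) (\<lambda>z. c * (z * deriv h z) + h z)" if "disc_series g h" for c g h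
      by (intro disc_series_add disc_series_cmult disc_series_euler that)
    have "disc_series (\<lambda>k. b k * Psi_coeff \<epsilon> k) (\<lambda>z. of_real \<xi> * (z * deriv (\<lambda>z. (1 + conv_coeff \<sigma> \<epsilon>) *
        (z * deriv (quot_id (V_transform lam f)) z) + quot_id (V_transform lam f) z) z) + ((1 + conv_coeff \<sigma> \<epsilon>) *
        (z * deriv (quot_id (V_transform lam f)) z) + quot_id (V_transform lam f) z))"
    proof (rule disc_series_cong[OF E[OF E[OF D]]])
      fix k :: nat
      have "b k * Psi_coeff \<epsilon> k = kernel_coeff \<xi> (conv_coeff \<sigma> \<epsilon>) k * (a (Suc k) * of_real (moment k))"
        using pd[of k] unfolding b_def Psi_coeff_def by (simp del: of_real_add of_real_mult add: less_imp_neq[symmetric])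
      then show "of_real \<xi> * (of_nat k * ((1 + conv_coeff \<sigma> \<epsilon>) * (of_nat k * (a (Suc k) * of_real (moment k))) + a (Suc k) * of_real (moment k)))
         + ((1 + conv_coeff \<sigma> \<epsilon>) * (of_nat k * (a (Suc k) * of_real (moment k))) + a (Suc k) * of_real (moment k)) = b k * Psi_coeff \<epsilon> k"
        by (simp add: kernel_coeff_def algebra_simps)
    qed simp
    then show ?thesis unfolding disc_series_def Q_def by (auto simp: sums_iff)
  qed
  show ?thesis
    unfolding pascu_convolution[OF a b Q]
    using half_plane_nonvanishing[OF b b0 \<beta> \<phi> disc_series_Psi Psi_coeff_0 ge Q] by auto
qed

text \<open>
  Since \<open>Psi \<epsilon> 0 = 1\<close> lies above the bound, an intermediate point has real part exactly
  \<open>1 - 1 / (2 (1 - \<beta>))\<close>. Rotating the half-plane by an angle \<open>\<phi>\<close> that is adapted to the imaginary part there,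
  the conformal map \<open>H\<close> of the disk onto it has all coefficients after the first equal to a constant \<open>\<kappa>\<close>. Its
  Hadamard product with \<open>Psi \<epsilon>\<close> is \<open>1 + \<kappa> (Psi \<epsilon> - 1)\<close>, which vanishes at that point.
\<close>
lemma extremal_not_in_pascu:
  assumes \<beta>: "\<beta> < 1" and \<epsilon>: "norm \<epsilon> = 1" and z: "norm z < 1" and lt: "Re (Psi \<epsilon> z) < 1 - 1 / (2 * (1 - \<beta>))"
  shows "\<exists>f \<in> class_W \<beta> \<alpha> \<gamma>. V_transform lam f \<notin> pascu \<sigma> \<xi>"
proof -
  have hol: "Psi \<epsilon> holomorphic_on ball 0 1" by (rule disc_series_holomorphic[OF disc_series_Psi])
  obtain y where y: "norm y < 1" "Re (Psi \<epsilon> y) = 1 - 1 / (2 * (1 - \<beta>))"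
  proof -
    have mem: "of_real t * z \<in> ball 0 1" if "t \<in> {0..1}" for t
      using that z mult_left_le_one_le[of "norm z" t] by (auto simp: norm_mult)
    have "continuous_on {0..1} (\<lambda>t. Re (Psi \<epsilon> (of_real t * z)))"
      by (intro continuous_intros continuous_on_compose2[OF holomorphic_on_imp_continuous_on[OF hol]])
         (use mem in auto)
    then have "\<exists>t. 0 \<le> t \<and> t \<le> 1 \<and> Re (Psi \<epsilon> (of_real t * z)) = 1 - 1 / (2 * (1 - \<beta>))"
      using lt \<beta> by (intro IVT2') (auto simp: Psi_0)
    then show ?thesis using that mem by force
  qed
  \<comment> \<open>this angle makes \<open>Psi \<epsilon> y - 1 = - (1 + i tan \<phi>) / (2 (1 - \<beta>)) = - 1 / \<kappa>\<close> below\<close>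
  define \<phi> where "\<phi> = arctan (- (2 * (1 - \<beta>) * Im (Psi \<epsilon> y)))"
  have c: "cos \<phi> > 0" unfolding \<phi>_def by (simp add: cos_arctan add_pos_nonneg)
  have tan: "sin \<phi> = - (2 * (1 - \<beta>) * Im (Psi \<epsilon> y)) * cos \<phi>"
  proof -
    have "tan \<phi> = - (2 * (1 - \<beta>) * Im (Psi \<epsilon> y))" unfolding \<phi>_def by (rule tan_arctan)
    then show ?thesis using c unfolding tan_def by (simp add: field_simps)
  qed
  define \<kappa> where "\<kappa> = of_real (2 * (1 - \<beta>) * cos \<phi>) * cis (- \<phi>)"
  define b where "b k = (if k = 0 then 1 else \<kappa>)" for k :: nat
  \<comment> \<open>solve \<open>W_op f = H\<close> coefficientwise\<close>
  define a where "a n = (case n of 0 \<Rightarrow> 0 | Suc k \<Rightarrow> b k / of_real ((1 + \<mu> * k) * (1 + \<nu> * k)))" for n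
  define f where "f z = (\<Sum>n. a n * z ^ n)" for z
  have pd: "1 \<le> (1 + \<mu> * k) * (1 + \<nu> * k)" for k :: nat
    using mult_mono[of 1 "1 + \<mu> * k" 1 "1 + \<nu> * k"] \<mu>_nonneg \<nu>_pos by auto
  have "norm (a n) \<le> max 1 (norm \<kappa>)" for n
  proof (cases n)
    case (Suc k)
    have "norm (a n) = norm (b k) / ((1 + \<mu> * k) * (1 + \<nu> * k))"
      unfolding a_def Suc nat.case norm_divide norm_of_real using pd[of k] by simp
    also have "\<dots> \<le> norm (b k) / 1"
      using pd[of k] by (intro divide_left_mono) auto
    also have "\<dots> \<le> max 1 (norm \<kappa>)" by (simp add: b_def)
    finally show ?thesis .
  qed (simp add: a_def)
  then have a: "disc_series a f" unfolding f_def[abs_def] by (rule disc_series_bounded)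
  have a01: "a 0 = 0" "a 1 = 1" by (simp_all add: a_def b_def)
  have b: "disc_series b (W_op f)"
  proof (rule disc_series_cong[OF disc_series_W_op[OF a a01(1)]])
    fix k :: nat
    have "complex_of_real ((1 + \<mu> * k) * (1 + \<nu> * k)) \<noteq> 0" using pd[of k] unfolding of_real_eq_0_iff by linarith
    then show "of_real ((1 + \<mu> * k) * (1 + \<nu> * k)) * a (Suc k) = b k"
      unfolding a_def nat.case by (rule nonzero_mult_div_cancel_left[of _ "b k", unfolded times_divide_eq_right[symmetric]])
  qed simp
  have W: "W_op f w = 1 - \<kappa> + \<kappa> * (1 / (1 - w))" if "norm w < 1" for w
  proof -
    have "disc_series b (\<lambda>w. 1 - \<kappa> + \<kappa> * (1 / (1 - w)))"
      by (rule disc_series_cong[OF disc_series_add[OF disc_series_const disc_series_cmult[OF disc_series_geometric]]]) (auto simp: b_def)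
    then show ?thesis using sums_unique2 disc_seriesD b that by blast
  qed
  have "0 < Re (cis \<phi> * (W_op f w - of_real \<beta>))" if w: "norm w < 1" for w
  proof -
    have w1: "w \<noteq> 1" using w by auto
    have "cis \<phi> * \<kappa> = of_real (2 * (1 - \<beta>) * cos \<phi>)"
      by (simp add: \<kappa>_def cis_mult)
    moreover have "cis \<phi> * (1 - \<kappa> + \<kappa> * i - of_real \<beta>) = of_real (1 - \<beta>) * cis \<phi> + (cis \<phi> * \<kappa>) * (i - 1)" for i
      by (simp add: algebra_simps)
    ultimately have eq: "cis \<phi> * (W_op f w - of_real \<beta>) =
        of_real (1 - \<beta>) * cis \<phi> + of_real (2 * (1 - \<beta>) * cos \<phi>) * (1 / (1 - w) - 1)"
      unfolding W[OF w] by (simp only:)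
    have "1 / 2 < Re (1 / (1 - w))"
    proof -
      have "(1 / (1 - w)) * 2 = (1 + w) / (1 - w) + 1" using w1 by (simp add: field_simps)
      moreover have "Re ((1 + w) / (1 - w)) > 0"
      proof -
        have "Re ((1 + w) / (1 - w)) = Re ((1 + w) * cnj (1 - w)) / (cmod (1 - w))\<^sup>2"
          by (subst complex_div_cnj) (simp only: Re_divide_of_real flip: of_real_power)
        also have "Re ((1 + w) * cnj (1 - w)) = 1 - (cmod w)\<^sup>2"
          unfolding cmod_power2 by (simp add: algebra_simps power2_eq_square)
        also have "(1 - (cmod w)\<^sup>2) / (cmod (1 - w))\<^sup>2 > 0"
          using w w1 by (intro divide_pos_pos) (auto simp: power_less_one_iff abs_square_less_1)
        finally show ?thesis .
      qed
      moreover have "Re i * 2 = Re j + 1" if "i * 2 = j + 1" for i j :: complex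
        using that by (simp add: complex_eq_iff)
      ultimately show ?thesis by fastforce
    qed
    then have "0 < (2 * (1 - \<beta>) * cos \<phi>) * (Re (1 / (1 - w)) - 1 / 2)"
      using \<beta> c by (intro mult_pos_pos) auto
    moreover have "Re (of_real p * cis \<phi> + of_real r * (i - 1)) = p * cos \<phi> + r * (Re i - 1)" for p r i
      by simp
    moreover have "(1 - \<beta>) * cos \<phi> + (2 * (1 - \<beta>) * cos \<phi>) * (x - 1) = (2 * (1 - \<beta>) * cos \<phi>) * (x - 1 / 2)" for x
      by (simp add: algebra_simps)
    ultimately show ?thesis unfolding eq by (simp only:)
  qed
  then have fW: "f \<in> class_W \<beta> \<alpha> \<gamma>"
    unfolding class_W_eq using class_A_I[OF a a01]
    by (intro CollectI conjI exI[of _ \<phi>] ballI) (simp_all only: mem_ball_0)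
  define Q where "Q e w = 1 - \<kappa> + \<kappa> * Psi e w" for e w
  have Q: "disc_series (\<lambda>k. b k * Psi_coeff e k) (Q e)" for e
    by (rule disc_series_cong[OF disc_series_add[OF disc_series_const disc_series_cmult[OF disc_series_Psi]]])
       (auto simp: b_def Q_def Psi_coeff_0)
  have "\<kappa> * (Psi \<epsilon> y - 1) = - 1"
  proof -
    have "of_real (2 * (1 - \<beta>) * cos \<phi>) * (Psi \<epsilon> y - 1) = - cis \<phi>"
    proof (rule complex_eqI)
      have "2 * (1 - \<beta>) * (Re (Psi \<epsilon> y) - 1) = - 1" using y(2) \<beta> by (simp add: field_simps)
      then have "cos \<phi> * (2 * (1 - \<beta>) * (Re (Psi \<epsilon> y) - 1)) = - cos \<phi>" by simp
      then show "Re (of_real (2 * (1 - \<beta>) * cos \<phi>) * (Psi \<epsilon> y - 1)) = Re (- cis \<phi>)"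
        by (simp add: mult_ac)
      show "Im (of_real (2 * (1 - \<beta>) * cos \<phi>) * (Psi \<epsilon> y - 1)) = Im (- cis \<phi>)"
        using tan by (simp add: mult_ac)
    qed
    then have "\<kappa> * (Psi \<epsilon> y - 1) = - (cis (- \<phi>) * cis \<phi>)"
      unfolding \<kappa>_def by (metis mult.commute mult.assoc mult_minus_right)
    then show ?thesis by (simp add: cis_mult)
  qed
  then have Q0: "Q \<epsilon> y = 0" by (simp add: Q_def algebra_simps)
  have "y \<noteq> 0" using y(2) \<beta> by (auto simp: Psi_0)
  then have "V_transform lam f \<notin> pascu \<sigma> \<xi>"
    unfolding pascu_convolution[OF a a01 b Q] using y(1) \<epsilon> Q0 by auto
  then show ?thesis using fW by blast
qed

text \<open>
  On the radius towards \<open>-1\<close> the kernel with \<open>\<epsilon> = 1\<close> is the boundary kernel at \<open>r t\<close>, which is bounded and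
  continuous on \<open>[0, 1]\<close>, so dominated convergence applies.
\<close>
lemma Psi_boundary_limit:
  "((\<lambda>n. Re (Psi 1 (- of_real (1 - 1 / real (n + 2))))) \<longlongrightarrow> threshold) sequentially"
proof -
  define r where "r n = 1 - 1 / real (n + 2)" for n
  have r: "0 \<le> r n" "r n < 1" "r n \<le> 1" for n by (auto simp: r_def)
  have rlim: "r \<longlonglongrightarrow> 1"
    unfolding r_def by real_asymp
  let ?B = "boundary_kernel \<sigma> \<xi>"
  obtain C where C: "\<And>t. t \<in> {0..1} \<Longrightarrow> \<bar>?B t\<bar> \<le> C" and Bm: "?B \<in> borel_measurable borel"
    using boundary_kernel_bdd(3)[OF \<sigma>(2)] unfolding bdd_borel_def by blast
  have cont: "continuous_on {0..1} ?B"
    unfolding boundary_kernel_def using \<sigma> by (intro continuous_intros) auto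
  have Re: "Re (Psi 1 (- of_real (r n))) = (\<integral>t. indicator {0..1} t *\<^sub>R (pi_density t * ?B (t * r n)) \<partial>lebesgue)"
    and meas: "(\<lambda>t. indicator {0..1} t *\<^sub>R (pi_density t * ?B (t * r n))) \<in> borel_measurable lebesgue" for n
  proof -
    have n: "norm (- complex_of_real (r n)) < 1" using r[of n] by simp
    have k: "indicator {0..1} t *\<^sub>R (pi_density t * Re (pascu_kernel \<xi> (conv_coeff \<sigma> 1) (of_real t * - of_real (r n))))
       = indicator {0..1} t *\<^sub>R (pi_density t * ?B (t * r n))" for t
    proof (cases "t \<in> {0..1}")
      case True
      then have "0 \<le> t * r n" using r[of n] by simp
      from pascu_kernel_boundary[OF \<sigma>(2) this]
      have "Re (pascu_kernel \<xi> (conv_coeff \<sigma> 1) (of_real t * - of_real (r n))) = ?B (t * r n)"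
        by simp
      then show ?thesis by simp
    qed simp
    show "Re (Psi 1 (- of_real (r n))) = (\<integral>t. indicator {0..1} t *\<^sub>R (pi_density t * ?B (t * r n)) \<partial>lebesgue)"
      unfolding Re_Psi(1)[OF n] set_lebesgue_integral_def k ..
    show "(\<lambda>t. indicator {0..1} t *\<^sub>R (pi_density t * ?B (t * r n))) \<in> borel_measurable lebesgue"
      using Re_Psi(2)[OF n, of 1] unfolding set_integrable_def k by auto
  qed
  have "(\<lambda>n. \<integral>t. indicator {0..1} t *\<^sub>R (pi_density t * ?B (t * r n)) \<partial>lebesgue)
    \<longlonglongrightarrow> (\<integral>t. indicator {0..1} t *\<^sub>R (pi_density t * ?B t) \<partial>lebesgue)"
  proof (rule integral_dominated_convergence[where w = "\<lambda>t. C * (indicator {0..1} t *\<^sub>R pi_density t)"])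
    show "(\<lambda>t. indicator {0..1} t *\<^sub>R (pi_density t * ?B t)) \<in> borel_measurable lebesgue"
      using density_integral(1)[OF boundary_kernel_bdd(3)[OF \<sigma>(2)]] unfolding set_integrable_def by auto
    show "integrable lebesgue (\<lambda>t. C * (indicator {0..1} t *\<^sub>R pi_density t))"
      using density_integrable unfolding set_integrable_def by (rule integrable_mult_right)
    show "AE t in lebesgue. (\<lambda>n. indicator {0..1} t *\<^sub>R (pi_density t * ?B (t * r n))) \<longlonglongrightarrow> indicator {0..1} t *\<^sub>R (pi_density t * ?B t)"
    proof (rule AE_I2)
      fix t :: real
      show "(\<lambda>n. indicator {0..1} t *\<^sub>R (pi_density t * ?B (t * r n))) \<longlonglongrightarrow> indicator {0..1} t *\<^sub>R (pi_density t * ?B t)"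
      proof (cases "t \<in> {0..1}")
        case True
        have "(\<lambda>n. ?B (t * r n)) \<longlonglongrightarrow> ?B t"
        proof (rule continuous_on_tendsto_compose[OF cont])
          show "(\<lambda>n. t * r n) \<longlonglongrightarrow> t" using tendsto_mult_left[OF rlim, of t] by simp
          show "\<forall>\<^sub>F n in sequentially. t * r n \<in> {0..1}"
            using True r by (intro always_eventually allI) (auto intro!: mult_le_one)
        qed (use True in auto)
        then show ?thesis by (intro tendsto_intros)
      qed simp
    qed
    fix n
    show "AE t in lebesgue. norm (indicator {0..1} t *\<^sub>R (pi_density t * ?B (t * r n))) \<le> C * (indicator {0..1} t *\<^sub>R pi_density t)"
    proof (rule AE_I2)
      fix t :: real
      show "norm (indicator {0..1} t *\<^sub>R (pi_density t * ?B (t * r n))) \<le> C * (indicator {0..1} t *\<^sub>R pi_density t)"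
      proof (cases "t \<in> {0..1}")
        case True
        then have "\<bar>?B (t * r n)\<bar> \<le> C" using r[of n] by (intro C) (auto intro!: mult_le_one)
        from mult_left_mono[OF this density_nonneg[OF True]] True density_nonneg[OF True]
        show ?thesis by (simp add: abs_mult mult.commute)
      qed simp
    qed
  qed (rule meas)
  then have "(\<lambda>n. Re (Psi 1 (- of_real (r n)))) \<longlonglongrightarrow> threshold"
    unfolding Re threshold_def set_lebesgue_integral_def .
  then show ?thesis unfolding r_def .
qed

lemma inclusion_and_sharpness:
  assumes \<beta>: "\<beta> < 1" and thr: "threshold = 1 - 1 / (2 * (1 - \<beta>))"
  shows "(\<forall>z\<in>ball 0 1. \<forall>\<epsilon>. norm \<epsilon> = 1 \<longrightarrow> 0 \<le> M_fun lam \<sigma> \<xi> \<alpha> \<gamma> \<mu> \<nu> \<epsilon> z)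
            \<longleftrightarrow> V_transform lam ` class_W \<beta> \<alpha> \<gamma> \<subseteq> pascu \<sigma> \<xi>" (is "?M \<longleftrightarrow> ?V")
    and "V_transform lam ` class_W \<beta> \<alpha> \<gamma> \<subseteq> pascu \<sigma> \<xi> \<longleftrightarrow> (\<forall>f\<in>class_W \<beta> \<alpha> \<gamma>. image_op f \<in> starlike_order \<sigma>)"
    and "\<beta>' < \<beta> \<Longrightarrow> \<not> V_transform lam ` class_W \<beta>' \<alpha> \<gamma> \<subseteq> pascu \<sigma> \<xi>"
proof -
  have M: "0 \<le> M_fun lam \<sigma> \<xi> \<alpha> \<gamma> \<mu> \<nu> \<epsilon> z \<longleftrightarrow> 1 - 1 / (2 * (1 - \<beta>)) \<le> Re (Psi \<epsilon> z)" if "norm z < 1" for \<epsilon> z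
    unfolding M_fun_eq[OF that] using norm_const_pos by (simp add: zero_le_mult_iff thr)
  show "?M \<longleftrightarrow> ?V"
  proof
    assume ?M
    then have "1 - 1 / (2 * (1 - \<beta>)) \<le> Re (Psi \<epsilon> z)" if "norm \<epsilon> = 1" "norm z < 1" for \<epsilon> z
      using that by (intro iffD1[OF M[OF that(2)]] \<open>?M\<close>[rule_format]) auto
    then show ?V using image_in_pascu[OF \<beta>] by blast
  next
    assume V: ?V
    show ?M
    proof (intro ballI allI impI, rule ccontr)
      fix z \<epsilon> :: complex assume z: "z \<in> ball 0 1" and \<epsilon>: "norm \<epsilon> = 1" and n: "\<not> 0 \<le> M_fun lam \<sigma> \<xi> \<alpha> \<gamma> \<mu> \<nu> \<epsilon> z"
      from z have "norm z < 1" by simp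
      with n have "Re (Psi \<epsilon> z) < 1 - 1 / (2 * (1 - \<beta>))" using M by (simp add: not_le)
      from extremal_not_in_pascu[OF \<beta> \<epsilon> \<open>norm z < 1\<close> this] V show False by blast
    qed
  qed
  have "f \<in> class_A" if "f \<in> class_W \<beta> \<alpha> \<gamma>" for f using that by (simp add: class_W_def)
  then show "V_transform lam ` class_W \<beta> \<alpha> \<gamma> \<subseteq> pascu \<sigma> \<xi> \<longleftrightarrow> (\<forall>f\<in>class_W \<beta> \<alpha> \<gamma>. image_op f \<in> starlike_order \<sigma>)"
    using pascu_iff_starlike by (auto simp: image_subset_iff)
  assume \<beta>': "\<beta>' < \<beta>"
  then have "threshold < 1 - 1 / (2 * (1 - \<beta>'))"
    unfolding thr using \<beta> by (simp add: frac_less2)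
  from order_tendstoD(2)[OF Psi_boundary_limit this]
  obtain n where n: "Re (Psi 1 (- of_real (1 - 1 / real (n + 2)))) < 1 - 1 / (2 * (1 - \<beta>'))"
    by (auto simp: eventually_sequentially)
  \<comment> \<open>the inequality for \<open>\<beta>'\<close> fails at this point of the disk, close to \<open>-1\<close>\<close>
  have "norm (- complex_of_real (1 - 1 / real (n + 2))) < 1"
    unfolding norm_minus_cancel norm_of_real by (auto simp: abs_less_iff)
  from extremal_not_in_pascu[OF _ _ this n] \<beta> \<beta>'
  show "\<not> V_transform lam ` class_W \<beta>' \<alpha> \<gamma> \<subseteq> pascu \<sigma> \<xi>" by auto
qed

end

theorem theorem3p1:
  fixes \<sigma> \<xi> \<alpha> \<gamma> \<mu> \<nu> \<beta> :: real and lam :: "real \<Rightarrow> real"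
  assumes "0 \<le> \<sigma>" "\<sigma> < 1" "0 \<le> \<xi>" "\<xi> \<le> 1" "\<alpha> \<ge> 0" "\<gamma> \<ge> 0"
    and "\<gamma> = 0 \<Longrightarrow> \<alpha> > 0"
    and "\<mu> \<ge> 0" "\<nu> \<ge> 0" "\<mu> + \<nu> = \<alpha> - \<gamma>" "\<mu> * \<nu> = \<gamma>"
    and "\<gamma> = 0 \<Longrightarrow> \<mu> = 0 \<and> \<nu> = \<alpha>"
    and "\<And>t. t \<in> {0..1} \<Longrightarrow> lam t \<ge> 0"
    and "set_integrable lebesgue {0..1} lam"
    and "(LINT t:{0..1}|lebesgue. lam t) = 1"
    and "\<beta> < 1"
    and "\<beta> / (1 - \<beta>) =
      - (LINT t:{0..1}|lebesgue.
           lam t * ((1 - \<xi>) * g_fun \<sigma> \<alpha> \<gamma> \<mu> \<nu> t + \<xi> * (2 * q_fun \<sigma> \<alpha> \<gamma> \<mu> \<nu> t - 1)))"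
    and "((\<lambda>t. t powr (1 / \<nu>) * Lam_fun lam \<nu> t) \<longlongrightarrow> 0) (at_right 0)"
    and "\<gamma> > 0 \<Longrightarrow> ((\<lambda>t. t powr (1 / \<mu>) * Pi_fun lam \<mu> \<nu> t) \<longlongrightarrow> 0) (at_right 0)"
  shows "((\<forall>z \<in> ball 0 1. \<forall>\<epsilon>. norm \<epsilon> = 1 \<longrightarrow> M_fun lam \<sigma> \<xi> \<alpha> \<gamma> \<mu> \<nu> \<epsilon> z \<ge> 0)
            \<longleftrightarrow> V_transform lam ` class_W \<beta> \<alpha> \<gamma> \<subseteq> pascu \<sigma> \<xi>)
       \<and> ((\<forall>z \<in> ball 0 1. \<forall>\<epsilon>. norm \<epsilon> = 1 \<longrightarrow> M_fun lam \<sigma> \<xi> \<alpha> \<gamma> \<mu> \<nu> \<epsilon> z \<ge> 0)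
            \<longleftrightarrow> (\<forall>f \<in> class_W \<beta> \<alpha> \<gamma>.
                  (\<lambda>z. of_real \<xi> * z * deriv (V_transform lam f) z
                        + of_real (1 - \<xi>) * V_transform lam f z) \<in> starlike_order \<sigma>))
       \<and> (\<forall>\<beta>' < \<beta>. \<not> V_transform lam ` class_W \<beta>' \<alpha> \<gamma> \<subseteq> pascu \<sigma> \<xi>)"
proof -
  have \<nu>: "0 < \<nu>"
  proof (cases "\<gamma> = 0")
    case False
    then have "0 < \<mu> * \<nu>" using assms(6,11) by simp
    then show ?thesis using assms(9) by (cases "\<nu> = 0") auto
  qed (use assms(7,12) in auto)
  interpret pascu_setting \<sigma> \<xi> \<alpha> \<gamma> \<mu> \<nu> lam
    by unfold_locales (use assms(1,2,8,10,11,13-15) \<nu> in auto)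
  have image: "image_op f = (\<lambda>z. of_real \<xi> * z * deriv (V_transform lam f) z
      + of_real (1 - \<xi>) * V_transform lam f z)" for f
    by (rule ext) (rule image_op_def)
  note main = inclusion_and_sharpness[OF assms(16) threshold_eq[OF assms(16,17)], unfolded image]
  show ?thesis
  proof (intro conjI allI impI)
    show "(\<forall>z\<in>ball 0 1. \<forall>\<epsilon>. norm \<epsilon> = 1 \<longrightarrow> M_fun lam \<sigma> \<xi> \<alpha> \<gamma> \<mu> \<nu> \<epsilon> z \<ge> 0)
        \<longleftrightarrow> V_transform lam ` class_W \<beta> \<alpha> \<gamma> \<subseteq> pascu \<sigma> \<xi>"
      by (rule main(1))
    then show "(\<forall>z\<in>ball 0 1. \<forall>\<epsilon>. norm \<epsilon> = 1 \<longrightarrow> M_fun lam \<sigma> \<xi> \<alpha> \<gamma> \<mu> \<nu> \<epsilon> z \<ge> 0)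
        \<longleftrightarrow> (\<forall>f\<in>class_W \<beta> \<alpha> \<gamma>. (\<lambda>z. of_real \<xi> * z * deriv (V_transform lam f) z
              + of_real (1 - \<xi>) * V_transform lam f z) \<in> starlike_order \<sigma>)"
      using main(2) by (rule trans)
  qed (rule main(3))
qed

end
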